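(* Let $A=\{\mathbf a_1,\ldots,\mathbf a_m\}\subset\mathbb Z^n$ be a vector configuration such that $\mathbb NA$ is pointed. For the toric ideal $I_A\subset K[x_1,\ldots,x_m]$ we have $$\nu(I_A)=\prod_{\mathbf b\in\mathbb NA} t_1(\mathbf b)\cdots t_{n_{\mathbf b}}(\mathbf b)\,\bigl(t_1(\mathbf b)+\cdots+t_{n_{\mathbf b}}(\mathbf b)\bigr)^{n_{\mathbf b}-2},$$ where $n_{\mathbf b}$ is the number of connected components of the graph $G(\mathbf b)$ and $t_i(\mathbf b)$ is the number of vertices of the connected component $G(\mathbf b)_i$ of $G(\mathbf b)$.
   Context: $K$ is a field. $\mathbb NA=\{l_1\mathbf a_1+\cdots+l_m\mathbf a_m : l_i\in\mathbb N\}$ with $0\in\mathbb N$; $\mathbb NA$ is pointed if zero is its only invertible element. The $A$-degree of $\mathbf x^{\mathbf u}=x_1^{u_1}\cdots x_m^{u_m}$ is $\deg_A(\mathbf x^{\mathbf u})=u_1\mathbf a_1+\cdots+u_m\mathbf a_m$. The toric ideal $I_A$ is the ideal generated by all binomials $\mathbf x^{\mathbf u}-\mathbf x^{\mathbf v}$ with $\deg_A(\mathbf x^{\mathbf u})=\deg_A(\mathbf x^{\mathbf v})$. Partial order on $\mathbb NA$: $\mathbf c\ge\mathbf d$ iff $\mathbf c=\mathbf d+\mathbf e$ for some $\mathbf e\in\mathbb NA$; $\lneqq$ denotes the strict order. For $\mathbf b\in\mathbb NA$, $I_{A,\mathbf b}$ is the ideal generated by all $\mathbf x^{\mathbf u}-\mathbf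 x^{\mathbf v}$ with $\deg_A(\mathbf x^{\mathbf u})=\deg_A(\mathbf x^{\mathbf v})\lneqq\mathbf b$. $G(\mathbf b)$ is the graph whose vertices are the monomials of $A$-degree $\mathbf b$ and whose edges are the sets $\{\mathbf x^{\mathbf u},\mathbf x^{\mathbf v}\}$ of distinct vertices with $\mathbf x^{\mathbf u}-\mathbf x^{\mathbf v}\in I_{A,\mathbf b}$; its connected components are denoted $G(\mathbf b)_1,\ldots,G(\mathbf b)_{n_{\mathbf b}}$. A factor of the product with $n_{\mathbf b}=1$ is $t_1(\mathbf b)\,t_1(\mathbf b)^{-1}=1$. $\nu(I_A)$ is the number of different minimal systems of binomial generators of $I_A$ (minimal: no proper subset generates $I_A$), where the sign of a binomial does not count. *)

theory Defs
  imports "HOL-Analysis.Finite_Cartesian_Product" "HOL-Library.Poly_Mapping"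
    "HOL-Library.Extended_Nat"
begin

text \<open>
  The monomials of \<open>K[x_1, \<dots>, x_m]\<close> are represented by their exponent vectors; the variables
  are indexed by a finite type \<open>'m\<close>.
\<close>

type_synonym 'm monom = "'m \<Rightarrow>\<^sub>0 nat"
type_synonym ('m, 'k) mpoly = "'m monom \<Rightarrow>\<^sub>0 'k"

lemma module_times: "module ((*) :: 'r::comm_ring_1 \<Rightarrow> 'r \<Rightarrow> 'r)"
  by unfold_locales (simp_all add: algebra_simps)

text \<open>An ideal of a commutative ring is a submodule of the ring over itself.\<close>

definition ideal_gen :: "'r::comm_ring_1 set \<Rightarrow> 'r set" where
  "ideal_gen S = module.span (*) S"

definition x_pow :: "'m monom \<Rightarrow> ('m, 'k::comm_ring_1) mpoly" where
  "x_pow u = Poly_Mapping.single u 1"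

definition NA :: "('m::finite \<Rightarrow> int ^ 'n) \<Rightarrow> (int ^ 'n) set" where
  "NA a = {\<Sum>i\<in>UNIV. int (l i) *s a i | l. True}"

definition pointed :: "'g::group_add set \<Rightarrow> bool" where
  "pointed S \<longleftrightarrow> (\<forall>c\<in>S. - c \<in> S \<longrightarrow> c = 0)"

definition deg_A :: "('m::finite \<Rightarrow> int ^ 'n) \<Rightarrow> 'm monom \<Rightarrow> int ^ 'n" where
  "deg_A a u = (\<Sum>i\<in>UNIV. int (Poly_Mapping.lookup u i) *s a i)"

definition toric_ideal :: "('m::finite \<Rightarrow> int ^ 'n) \<Rightarrow> ('m, 'k::field) mpoly set" where
  "toric_ideal a = ideal_gen {x_pow u - x_pow v | u v. deg_A a u = deg_A a v}"

definition le_NA :: "('m::finite \<Rightarrow> int ^ 'n) \<Rightarrow> int ^ 'n \<Rightarrow> int ^ 'n \<Rightarrow> bool" where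
  "le_NA a d c \<longleftrightarrow> (\<exists>e\<in>NA a. c = d + e)"

definition less_NA :: "('m::finite \<Rightarrow> int ^ 'n) \<Rightarrow> int ^ 'n \<Rightarrow> int ^ 'n \<Rightarrow> bool" where
  "less_NA a d c \<longleftrightarrow> le_NA a d c \<and> d \<noteq> c"

definition toric_ideal_below ::
    "('m::finite \<Rightarrow> int ^ 'n) \<Rightarrow> int ^ 'n \<Rightarrow> ('m, 'k::field) mpoly set" where
  "toric_ideal_below a b =
     ideal_gen {x_pow u - x_pow v | u v. deg_A a u = deg_A a v \<and> less_NA a (deg_A a u) b}"

text \<open>
  The graph \<open>G(b)\<close> depends on the field \<open>K\<close> through the ideal; the argument of type \<open>'k itself\<close>
  selects it.
\<close>

definition G_verts :: "('m::finite \<Rightarrow> int ^ 'n) \<Rightarrow> int ^ 'n \<Rightarrow> 'm monom set" where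
  "G_verts a b = {u. deg_A a u = b}"

definition G_edges ::
    "'k::field itself \<Rightarrow> ('m::finite \<Rightarrow> int ^ 'n) \<Rightarrow> int ^ 'n \<Rightarrow> 'm monom set set" where
  "G_edges K a b = {{u, v} | u v. u \<in> G_verts a b \<and> v \<in> G_verts a b \<and> u \<noteq> v \<and>
     (x_pow u - x_pow v :: ('m, 'k) mpoly) \<in> toric_ideal_below a b}"

definition graph_components :: "'v set \<Rightarrow> 'v set set \<Rightarrow> 'v set set" where
  "graph_components V E = V // {(u, v). u \<in> V \<and> v \<in> V \<and> (u, v) \<in> {(p, q). {p, q} \<in> E}\<^sup>*}"

definition G_comps ::
    "'k::field itself \<Rightarrow> ('m::finite \<Rightarrow> int ^ 'n) \<Rightarrow> int ^ 'n \<Rightarrow> 'm monom set set" where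
  "G_comps K a b = graph_components (G_verts a b) (G_edges K a b)"

definition ecard :: "'a set \<Rightarrow> enat" where
  "ecard S = (if finite S then enat (card S) else \<infinity>)"

definition n_comps :: "'k::field itself \<Rightarrow> ('m::finite \<Rightarrow> int ^ 'n) \<Rightarrow> int ^ 'n \<Rightarrow> enat" where
  "n_comps K a b = ecard (G_comps K a b)"

text \<open>
  The factor \<open>t_1 \<cdots> t_n (t_1 + \<dots> + t_n)^(n - 2)\<close> of \<open>b\<close>. For \<open>n = 1\<close> it is
  \<open>t_1 t_1^(-1) = 1\<close>; there the truncated exponent \<open>n - 2\<close> on \<open>nat\<close> would be wrong.
  If no \<open>a i\<close> is zero, pointedness makes every \<open>G(b)\<close> finite and no infinite value occurs.
  If some \<open>a i\<close> is zero, then \<open>G(0)\<close> consists of infinitely many isolated vertices, and its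
  factor is \<open>\<infinity>\<close>, as is the number of minimal systems of generators.
\<close>

definition G_factor :: "'k::field itself \<Rightarrow> ('m::finite \<Rightarrow> int ^ 'n) \<Rightarrow> int ^ 'n \<Rightarrow> enat" where
  "G_factor K a b =
     (let \<C> = G_comps K a b in
      if infinite \<C> then \<infinity>
      else if card \<C> = 1 then 1
      else (\<Prod>C\<in>\<C>. ecard C) * (\<Sum>C\<in>\<C>. ecard C) ^ (card \<C> - 2))"

definition is_binomial :: "('m, 'k::comm_ring_1) mpoly \<Rightarrow> bool" where
  "is_binomial f \<longleftrightarrow> (\<exists>u v. f = x_pow u - x_pow v)"

definition minimal_binomial_system ::
    "('m, 'k::comm_ring_1) mpoly set \<Rightarrow> ('m, 'k) mpoly set \<Rightarrow> bool" where
  "minimal_binomial_system I S \<longleftrightarrow>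
     (\<forall>f\<in>S. is_binomial f) \<and> ideal_gen S = I \<and> (\<forall>T. T \<subset> S \<longrightarrow> ideal_gen T \<noteq> I)"

text \<open>
  To disregard signs, every binomial \<open>f\<close> of a system is replaced by the set \<open>{f, - f}\<close>.
\<close>

definition up_to_sign :: "'r::uminus set \<Rightarrow> 'r set set" where
  "up_to_sign S = (\<lambda>f. {f, - f}) ` S"

definition \<nu> :: "('m, 'k::comm_ring_1) mpoly set \<Rightarrow> enat" where
  "\<nu> I = ecard (up_to_sign ` {S. minimal_binomial_system I S})"

end

theory Submission
  imports Defs
begin

text \<open>
  A binomial \<open>x^u - x^v\<close> lies in an ideal generated by binomials iff \<open>(u, v)\<close> lies in the congruence
  on the monoid of monomials generated by the exponent pairs of the generators. Signs being
  disregarded, a system of binomials thus is a set of edges between monomials.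

  If no \<open>a i\<close> is zero, all fibres of the degree map are finite, and by induction along the order
  on \<open>NA a\<close> a homogeneous edge set generates the toric ideal iff for every \<open>b\<close> its edges of degree
  \<open>b\<close> connect the components of \<open>G(b)\<close>. A minimal system is therefore an independent choice, for
  each \<open>b\<close>, of a spanning tree on the components of \<open>G(b)\<close> whose edges are realised by vertices. The
  number \<open>T\<close> of these is found by induction on the number \<open>n\<close> of components: counting pairs of a tree
  and one of its edges gives \<open>(n - 1) T = (\<Sum>e. T\<^sub>e)\<close>, where \<open>T\<^sub>e\<close> counts the trees after merging the
  two components joined by \<open>e\<close>. Only finitely many \<open>b\<close> matter, by Dickson's lemma for the pairs of
  monomials of equal degree.

  If \<open>a i = 0\<close>, both sides are infinite: \<open>x_i - 1\<close> can be replaced by \<open>x_i^k - 1\<close> and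
  \<open>x_i^(k+1) - 1\<close> for every \<open>k \<ge> 2\<close>.
\<close>

section \<open>Counting minimal connecting edge sets\<close>

text \<open>Connectivity of the contracted graph in closed-set form: no walks occur, and each use
  only names a set \<open>X\<close> that has to spread through blocks and edges.\<close>

definition connects :: "'v set \<Rightarrow> ('v \<Rightarrow> 'c) \<Rightarrow> 'v set set \<Rightarrow> bool" where
  "connects V c P \<longleftrightarrow>
     (\<forall>X. (\<forall>x\<in>V. \<forall>y\<in>V. c x = c y \<longrightarrow> x \<in> X \<longrightarrow> y \<in> X) \<longrightarrow>
          (\<forall>x y. {x, y} \<in> P \<longrightarrow> x \<in> X \<longrightarrow> y \<in> X) \<longrightarrow>
          (\<forall>x\<in>V. \<forall>y\<in>V. x \<in> X \<longrightarrow> y \<in> X))"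

definition edges_on :: "'v set \<Rightarrow> 'v set set" where
  "edges_on V = {{x, y} | x y. x \<in> V \<and> y \<in> V \<and> x \<noteq> y}"

text \<open>
  These are the spanning trees of the graph obtained from \<open>V\<close> by contracting every class of the
  labelling \<open>c\<close> to a point.
\<close>

definition trees :: "'v set \<Rightarrow> ('v \<Rightarrow> 'c) \<Rightarrow> 'v set set set" where
  "trees V c = {P. P \<subseteq> edges_on V \<and> connects V c P \<and> (\<forall>P'. P' \<subset> P \<longrightarrow> \<not> connects V c P')}"

text \<open>Contraction of the edge \<open>{u, v}\<close> by relabelling. The vertices stay, so
  edges before and after contraction are literally the same sets.\<close>

definition merge :: "('v \<Rightarrow> 'c) \<Rightarrow> 'v \<Rightarrow> 'v \<Rightarrow> 'v \<Rightarrow> 'c" where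
  "merge c u v = (\<lambda>x. if c x = c v then c u else c x)"

section \<open>Connecting edge sets and contraction of an edge\<close>

lemma finite_edges_on: "finite V \<Longrightarrow> finite (edges_on V)"
  by (rule finite_subset[of _ "Pow V"]) (auto simp: edges_on_def)

lemma finite_trees: "finite V \<Longrightarrow> finite (trees V c)"
  by (rule finite_subset[of _ "Pow (edges_on V)"]) (auto simp: trees_def finite_edges_on)

lemma pair_in_edges_on: "{x, y} \<in> edges_on V \<longleftrightarrow> x \<in> V \<and> y \<in> V \<and> x \<noteq> y"
  by (auto simp: edges_on_def doubleton_eq_iff)

lemma connectsI:
  assumes "\<And>X x y. (\<And>x y. x \<in> V \<Longrightarrow> y \<in> V \<Longrightarrow> c x = c y \<Longrightarrow> x \<in> X \<Longrightarrow> y \<in> X) \<Longrightarrow>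
    (\<And>x y. {x, y} \<in> P \<Longrightarrow> x \<in> X \<Longrightarrow> y \<in> X) \<Longrightarrow> x \<in> V \<Longrightarrow> y \<in> V \<Longrightarrow> x \<in> X \<Longrightarrow> y \<in> X"
  shows "connects V c P"
  unfolding connects_def
proof (intro allI impI ballI)
  fix X x y
  assume "\<forall>x\<in>V. \<forall>y\<in>V. c x = c y \<longrightarrow> x \<in> X \<longrightarrow> y \<in> X"
    and "\<forall>x y. {x, y} \<in> P \<longrightarrow> x \<in> X \<longrightarrow> y \<in> X" and "x \<in> V" "y \<in> V" "x \<in> X"
  then show "y \<in> X" by (intro assms[of X x y]) blast+
qed

lemma connectsD:
  assumes "connects V c P"
    and "\<And>x y. x \<in> V \<Longrightarrow> y \<in> V \<Longrightarrow> c x = c y \<Longrightarrow> x \<in> X \<Longrightarrow> y \<in> X"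
    and "\<And>x y. {x, y} \<in> P \<Longrightarrow> x \<in> X \<Longrightarrow> y \<in> X"
    and "x \<in> V" "y \<in> V" "x \<in> X"
  shows "y \<in> X"
  using assms(1)[unfolded connects_def, THEN spec[of _ X]] assms(2-) by blast

lemma
  assumes "P \<in> trees V c"
  shows tree_subset: "P \<subseteq> edges_on V" and tree_connects: "connects V c P"
  using assms by (simp_all add: trees_def)

lemma edges_onE:
  assumes "e \<in> edges_on V"
  obtains x y where "e = {x, y}" "x \<in> V" "y \<in> V" "x \<noteq> y"
  using assms by (auto simp: edges_on_def)

text \<open>A set is closed under the blocks of the merged labelling iff it is closed under those of
  \<open>c\<close> and does not separate \<open>u\<close> from \<open>v\<close>; the latter is
  closedness under the edge \<open>{u, v}\<close>.\<close>

lemma connects_merge: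
  assumes "u \<in> V" "v \<in> V"
  shows "connects V (merge c u v) P \<longleftrightarrow> connects V c (insert {u, v} P)"
proof
  assume *: "connects V (merge c u v) P"
  show "connects V c (insert {u, v} P)"
  proof (rule connectsI)
    fix X x y
    assume cl: "\<And>x y. x \<in> V \<Longrightarrow> y \<in> V \<Longrightarrow> c x = c y \<Longrightarrow> x \<in> X \<Longrightarrow> y \<in> X"
      and ed: "\<And>x y. {x, y} \<in> insert {u, v} P \<Longrightarrow> x \<in> X \<Longrightarrow> y \<in> X"
      and xy: "x \<in> V" "y \<in> V" "x \<in> X"
    have uv: "u \<in> X \<longleftrightarrow> v \<in> X"
      using ed[of u v] ed[of v u] by (auto simp: insert_commute)
    show "y \<in> X"
    proof (rule connectsD[OF * _ _ xy])
      fix x y assume "x \<in> V" "y \<in> V" "merge c u v x = merge c u v y" "x \<in> X"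
      then show "y \<in> X"
        using cl[of x y] cl[of x v] cl[of u y] cl[of x u] cl[of v y] assms uv
        by (auto simp: merge_def split: if_splits)
    qed (use ed in auto)
  qed
next
  assume *: "connects V c (insert {u, v} P)"
  show "connects V (merge c u v) P"
  proof (rule connectsI)
    fix X x y
    assume cl: "\<And>x y. x \<in> V \<Longrightarrow> y \<in> V \<Longrightarrow> merge c u v x = merge c u v y \<Longrightarrow> x \<in> X \<Longrightarrow> y \<in> X"
      and ed: "\<And>x y. {x, y} \<in> P \<Longrightarrow> x \<in> X \<Longrightarrow> y \<in> X"
      and xy: "x \<in> V" "y \<in> V" "x \<in> X"
    show "y \<in> X"
    proof (rule connectsD[OF * _ _ xy])
      fix x y assume "x \<in> V" "y \<in> V" "c x = c y" "x \<in> X"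
      then show "y \<in> X" using cl[of x y] by (simp add: merge_def)
    next
      fix x y assume xy: "{x, y} \<in> insert {u, v} P" "x \<in> X"
      have "merge c u v u = merge c u v v" by (simp add: merge_def)
      then show "y \<in> X" using ed[of x y] cl[of u v] cl[of v u] assms xy
        by (auto simp: doubleton_eq_iff)
    qed
  qed
qed

text \<open>An edge inside a block is redundant: merging equal labels changes nothing, so by
  \<open>connects_merge\<close> the edge could be dropped, against minimality.\<close>

lemma tree_edge:
  assumes "P \<in> trees V c" "{u, v} \<in> P"
  shows "u \<in> V" "v \<in> V" "c u \<noteq> c v"
proof -
  have "{u, v} \<in> edges_on V" using tree_subset[OF assms(1)] assms(2) by blast
  then show uv: "u \<in> V" "v \<in> V" by (simp_all add: pair_in_edges_on)
  show "c u \<noteq> c v"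
  proof
    assume "c u = c v"
    then have "merge c u v = c" by (auto simp: merge_def)
    then have "connects V c (P - {{u, v}}) \<longleftrightarrow> connects V c P"
      using connects_merge[OF uv, of c "P - {{u, v}}"] assms by (simp add: insert_absorb)
    then show False using assms unfolding trees_def by blast
  qed
qed

text \<open>A smaller connecting set after contraction would, with the edge put back, be a smaller
  one before it.\<close>

lemma tree_remove:
  assumes "P \<in> trees V c" "{u, v} \<in> P"
  shows "P - {{u, v}} \<in> trees V (merge c u v)"
proof -
  note uv = tree_edge(1,2)[OF assms]
  have "connects V (merge c u v) (P - {{u, v}})"
    using assms by (simp add: connects_merge[OF uv] insert_absorb trees_def)
  moreover have "\<not> connects V (merge c u v) P'" if "P' \<subset> P - {{u, v}}" for P'
  proof -
    have "insert {u, v} P' \<subset> P" using that assms(2) by auto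
    then show ?thesis using assms(1) by (simp add: connects_merge[OF uv] trees_def)
  qed
  moreover have "P - {{u, v}} \<subseteq> edges_on V" using tree_subset[OF assms(1)] by blast
  ultimately show ?thesis by (simp add: trees_def)
qed

lemma image_merge:
  assumes "u \<in> V" "c u \<noteq> c v"
  shows "merge c u v ` V = c ` V - {c v}"
  using assms by (auto simp: merge_def image_iff)

lemma card_image_merge:
  assumes "finite V" "u \<in> V" "v \<in> V" "c u \<noteq> c v"
  shows "card (c ` V) = Suc (card (merge c u v ` V))"
  unfolding image_merge[OF assms(2,4)] using assms by (intro card.remove) auto

section \<open>The number of edges of a tree\<close>

lemma connects_empty:
  assumes "connects V c {}" "x \<in> V"
  shows "c ` V = {c x}"
proof -
  have "y \<in> {z. c z = c x}" if "y \<in> V" for y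
    using assms(1)
  proof (rule connectsD)
    fix x' y' assume "c x' = c y'" "x' \<in> {z. c z = c x}"
    then show "y' \<in> {z. c z = c x}" by simp
  qed (use assms(2) that in simp_all)
  then show ?thesis using assms(2) by fast
qed

text \<open>Contracting one edge lowers the number of blocks by at most one, and the empty edge set
  connects only a single block.\<close>

lemma connects_card:
  assumes "finite P" "P \<subseteq> edges_on V" "connects V c P" "finite V" "V \<noteq> {}"
  shows "card (c ` V) \<le> Suc (card P)"
  using assms
proof (induction P arbitrary: c rule: finite_induct)
  case empty
  then obtain x where "x \<in> V" by blast
  then show ?case using connects_empty[OF empty(2)] by simp
next
  case (insert e P)
  then obtain u v where e: "e = {u, v}" "u \<in> V" "v \<in> V" by (auto simp: edges_on_def)
  have "card (merge c u v ` V) \<le> Suc (card P)"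
    using insert e by (intro insert.IH) (auto simp: connects_merge)
  moreover have "card (c ` V) \<le> Suc (card (merge c u v ` V))"
  proof (cases "c u = c v")
    case True
    then have "merge c u v = c" by (auto simp: merge_def)
    then show ?thesis by simp
  next
    case False
    then show ?thesis using e insert.prems by (simp add: image_merge card_Diff_singleton)
  qed
  ultimately show ?case using insert.hyps by simp
qed

text \<open>The bound of \<open>connects_card\<close> is attained, because by
  \<open>tree_edge\<close> every contraction joins two different blocks.\<close>

lemma tree_card:
  assumes "P \<in> trees V c" "finite V" "V \<noteq> {}"
  shows "Suc (card P) = card (c ` V)"
proof -
  have "finite P" using tree_subset[OF assms(1)] finite_edges_on[OF assms(2)] by (rule finite_subset)
  then show ?thesis using assms
  proof (induction "card P" arbitrary: P c)
    case 0
    then have "P = {}" by simp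
    moreover obtain x where "x \<in> V" using 0 by blast
    ultimately show ?case using connects_empty[of V c x] 0 by (simp add: trees_def)
  next
    case (Suc n)
    then obtain e where e: "e \<in> P" by fastforce
    then obtain u v where uv: "e = {u, v}"
      using tree_subset[OF Suc.prems(2)] by (meson edges_onE subsetD)
    note E = tree_edge[OF Suc.prems(2) e[unfolded uv]]
    have "Suc (card (P - {e})) = card (merge c u v ` V)"
    proof (rule Suc.hyps)
      show "n = card (P - {e})" using Suc.hyps(2) e by (simp add: card_Diff_singleton)
      show "P - {e} \<in> trees V (merge c u v)"
        unfolding uv by (rule tree_remove[OF Suc.prems(2) e[unfolded uv]])
    qed (use Suc.prems in simp_all)
    moreover have "card (c ` V) = Suc (card (merge c u v ` V))"
      by (rule card_image_merge[OF Suc.prems(3) E])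
    ultimately show ?case using card.remove[OF Suc.prems(1) e] by simp
  qed
qed

text \<open>The converse of \<open>tree_remove\<close>. Minimality comes from counting: with one
  edge more than \<open>Q\<close> the set has just as many edges as \<open>connects_card\<close>
  demands, so no proper subset connects.\<close>

lemma tree_insert:
  assumes "Q \<in> trees V (merge c u v)" "u \<in> V" "v \<in> V" "c u \<noteq> c v" "finite V"
  shows "insert {u, v} Q \<in> trees V c" "{u, v} \<notin> Q"
proof -
  show "{u, v} \<notin> Q"
    using tree_edge(3)[OF assms(1), of u v] by (auto simp: merge_def)
  have ne: "V \<noteq> {}" using assms by auto
  have sub: "insert {u, v} Q \<subseteq> edges_on V"
    using tree_subset[OF assms(1)] assms(2-4) pair_in_edges_on[of u v V] by fast
  have fin: "finite (insert {u, v} Q)" by (rule finite_subset[OF sub finite_edges_on[OF assms(5)]])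
  have card: "Suc (Suc (card Q)) = card (c ` V)"
    unfolding tree_card[OF assms(1,5) ne] by (rule card_image_merge[OF assms(5,2,3,4), symmetric])
  have "\<not> connects V c P'" if P': "P' \<subset> insert {u, v} Q" for P'
  proof
    assume "connects V c P'"
    moreover have "finite P'" "P' \<subseteq> edges_on V" using P' fin sub by (auto intro: finite_subset)
    ultimately have "card (c ` V) \<le> Suc (card P')" using assms(5) ne by (intro connects_card)
    moreover have "card P' < card (insert {u, v} Q)" using P' fin by (rule psubset_card_mono[rotated])
    moreover have "card (insert {u, v} Q) \<le> Suc (card Q)" by (simp add: card_insert_le_m1 card_insert_if)
    ultimately show False using card by simp
  qed
  moreover have "connects V c (insert {u, v} Q)"
    using tree_connects[OF assms(1)] by (simp add: connects_merge assms(2,3))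
  ultimately show "insert {u, v} Q \<in> trees V c" using sub by (simp add: trees_def)
qed

section \<open>Double counting of trees and their edges\<close>

lemma card_trees_containing:
  assumes "u \<in> V" "v \<in> V" "c u \<noteq> c v" "finite V"
  shows "card {P \<in> trees V c. {u, v} \<in> P} = card (trees V (merge c u v))"
proof (rule bij_betw_same_card, rule bij_betw_byWitness[where f' = "insert {u, v}"])
  show "\<forall>P\<in>{P \<in> trees V c. {u, v} \<in> P}. insert {u, v} (P - {{u, v}}) = P"
    by (simp add: insert_absorb)
  show "\<forall>Q\<in>trees V (merge c u v). insert {u, v} Q - {{u, v}} = Q"
    using tree_insert(2)[OF _ assms] by simp
  show "(\<lambda>P. P - {{u, v}}) ` {P \<in> trees V c. {u, v} \<in> P} \<subseteq> trees V (merge c u v)"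
    using tree_remove by auto
  show "insert {u, v} ` trees V (merge c u v) \<subseteq> {P \<in> trees V c. {u, v} \<in> P}"
    using tree_insert(1)[OF _ assms] by auto
qed

lemma card_oriented_edges:
  assumes "P \<subseteq> edges_on V" "finite V"
  shows "card {(u, v). {u, v} \<in> P} = 2 * card P"
proof -
  have "finite P" using assms finite_edges_on finite_subset by blast
  have two: "card {(u, v). {u, v} = e} = 2" if e: "e \<in> P" for e
  proof -
    obtain x y where xy: "e = {x, y}" "x \<noteq> y" using assms e by (auto simp: edges_on_def)
    then have "{(u, v). {u, v} = e} = {(x, y), (y, x)}" by (auto simp: doubleton_eq_iff)
    then show ?thesis using xy by simp
  qed
  have "{(u, v). {u, v} \<in> P} = (\<Union>e\<in>P. {(u, v). {u, v} = e})" by auto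
  also have "card \<dots> = (\<Sum>e\<in>P. card {(u, v). {u, v} = e})"
    using two \<open>finite P\<close> by (intro card_UN_disjoint) (auto intro: card_ge_0_finite)
  finally show ?thesis using two by simp
qed

text \<open>Both sides count pairs of a tree and one of its edges with an order of its ends: by
  trees via \<open>tree_card\<close>, by edges via contraction. Ordered ends spare a choice of
  orientation and cause the factor 2.\<close>

lemma sum_card_trees_merge:
  assumes "finite V" "V \<noteq> {}"
  shows "2 * (card (c ` V) - 1) * card (trees V c) =
    (\<Sum>u\<in>V. \<Sum>v\<in>{v \<in> V. c v \<noteq> c u}. card (trees V (merge c u v)))"
proof -
  have "2 * (card (c ` V) - 1) * card (trees V c) = (\<Sum>P\<in>trees V c. 2 * (card (c ` V) - 1))"
    by simp
  also have "\<dots> = (\<Sum>P\<in>trees V c. card {(u, v). {u, v} \<in> P})"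
  proof (rule sum.cong)
    fix P assume P: "P \<in> trees V c"
    then show "2 * (card (c ` V) - 1) = card {(u, v). {u, v} \<in> P}"
      using card_oriented_edges[of P V] tree_card[OF P assms] assms by (simp add: trees_def)
  qed simp
  also have "\<dots> = (\<Sum>P\<in>trees V c. \<Sum>z\<in>V \<times> V. if {fst z, snd z} \<in> P then 1 else 0)"
  proof (rule sum.cong)
    fix P assume P: "P \<in> trees V c"
    have "{(u, v). {u, v} \<in> P} = {z \<in> V \<times> V. {fst z, snd z} \<in> P}"
      using tree_edge(1,2)[OF P] by auto
    then show "card {(u, v). {u, v} \<in> P} = (\<Sum>z\<in>V \<times> V. if {fst z, snd z} \<in> P then 1 else 0)"
      using assms by (simp add: sum.If_cases Int_def)
  qed simp
  also have "\<dots> = (\<Sum>z\<in>V \<times> V. \<Sum>P\<in>trees V c. if {fst z, snd z} \<in> P then 1 else 0)"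
    by (rule sum.swap)
  also have "\<dots> = (\<Sum>z\<in>V \<times> V. card {P \<in> trees V c. {fst z, snd z} \<in> P})"
    using finite_trees[OF assms(1), of c] by (simp add: sum.If_cases Int_def)
  also have "\<dots> = (\<Sum>u\<in>V. \<Sum>v\<in>V. card {P \<in> trees V c. {u, v} \<in> P})"
    by (simp add: sum.cartesian_product split_def)
  also have "\<dots> = (\<Sum>u\<in>V. \<Sum>v\<in>{v \<in> V. c v \<noteq> c u}. card (trees V (merge c u v)))"
  proof (rule sum.cong[OF refl])
    fix u assume u: "u \<in> V"
    \<comment> \<open>Pairs within a block lie in no tree, so they can be left out of the
      sum.\<close>
    have "card {P \<in> trees V c. {u, v} \<in> P} = 0" if "c v = c u" for v
    proof -
      have "{P \<in> trees V c. {u, v} \<in> P} = {}" using tree_edge(3)[of _ V c u v] that by auto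
      then show ?thesis by (simp only: card.empty)
    qed
    then have "(\<Sum>v\<in>V. card {P \<in> trees V c. {u, v} \<in> P}) =
        (\<Sum>v\<in>{v \<in> V. c v \<noteq> c u}. card {P \<in> trees V c. {u, v} \<in> P})"
      using assms by (intro sum.mono_neutral_right) auto
    also have "\<dots> = (\<Sum>v\<in>{v \<in> V. c v \<noteq> c u}. card (trees V (merge c u v)))"
      using u assms by (intro sum.cong refl card_trees_containing) auto
    finally show "(\<Sum>v\<in>V. card {P \<in> trees V c. {u, v} \<in> P}) =
      (\<Sum>v\<in>{v \<in> V. c v \<noteq> c u}. card (trees V (merge c u v)))" .
  qed
  finally show ?thesis .
qed

section \<open>The number of trees in terms of the block sizes\<close>

lemma trees_single_block:
  assumes "card (c ` V) = 1"
  shows "trees V c = {{}}"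
proof -
  obtain l where "c ` V = {l}" using assms by (rule card_1_singletonE)
  then have "c x = c y" if "x \<in> V" "y \<in> V" for x y using that by (metis imageI singletonD)
  then have "connects V c {}" unfolding connects_def by metis
  then show ?thesis unfolding trees_def by blast
qed

text \<open>With \<open>fibre_comp\<close> as labelling these are the numbers t_i of the
  theorem.\<close>

definition block_card :: "'v set \<Rightarrow> ('v \<Rightarrow> 'c) \<Rightarrow> 'c \<Rightarrow> nat" where
  "block_card V c l = card {x \<in> V. c x = l}"

text \<open>Two factors s and t give way to s + t, which amounts to a factor (s + t) / (s t) = 1/s +
  1/t. Over the reals this is a term in \<open>u\<close> plus a term in \<open>v\<close>, so that
  the double sum over edges splits.\<close>

lemma prod_block_card_merge:
  assumes "finite V" "u \<in> V" "v \<in> V" "c u \<noteq> c v"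
  shows "real (\<Prod>l\<in>merge c u v ` V. block_card V (merge c u v) l) =
    real (\<Prod>l\<in>c ` V. block_card V c l) *
      (1 / real (block_card V c (c u)) + 1 / real (block_card V c (c v)))"
proof -
  let ?L = "c ` V - {c u, c v}"
  have L: "c ` V = insert (c u) (insert (c v) ?L)" using assms by auto
  have L': "merge c u v ` V = insert (c u) ?L" using assms by (subst image_merge) auto
  have "{x \<in> V. merge c u v x = c u} = {x \<in> V. c x = c u} \<union> {x \<in> V. c x = c v}"
    by (auto simp: merge_def)
  then have bu: "block_card V (merge c u v) (c u) = block_card V c (c u) + block_card V c (c v)"
    using assms unfolding block_card_def by (subst card_Un_disjoint[symmetric]) auto
  have "{x \<in> V. merge c u v x = l} = {x \<in> V. c x = l}" if "l \<in> ?L" for l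
    using that by (auto simp: merge_def)
  then have bl: "block_card V (merge c u v) l = block_card V c l" if "l \<in> ?L" for l
    using that by (simp add: block_card_def)
  have pos: "block_card V c (c u) > 0" "block_card V c (c v) > 0"
    using assms by (auto simp: block_card_def card_gt_0_iff)
  have "(\<Prod>l\<in>merge c u v ` V. block_card V (merge c u v) l) =
      (block_card V c (c u) + block_card V c (c v)) * (\<Prod>l\<in>?L. block_card V c l)"
    unfolding L' using assms bl by (subst prod.insert) (auto simp: bu)
  moreover have "(\<Prod>l\<in>c ` V. block_card V c l) =
      block_card V c (c u) * (block_card V c (c v) * (\<Prod>l\<in>?L. block_card V c l))"
    using assms by (subst L) simp
  ultimately show ?thesis using pos by (simp add: field_simps)
qed

text \<open>Each block of size s contributes s terms 1/s.\<close>

lemma sum_inverse_block_card: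
  assumes "finite V" "L \<subseteq> c ` V"
  shows "(\<Sum>v\<in>{v \<in> V. c v \<in> L}. 1 / real (block_card V c (c v))) = real (card L)"
proof -
  have "(\<Sum>v\<in>{v \<in> V. c v \<in> L}. 1 / real (block_card V c (c v))) =
      (\<Sum>l\<in>L. \<Sum>v\<in>{v \<in> {v \<in> V. c v \<in> L}. c v = l}. 1 / real (block_card V c (c v)))"
    using assms finite_subset by (intro sum.group[symmetric]) auto
  also have "\<dots> = (\<Sum>l\<in>L. 1)"
  proof (rule sum.cong)
    fix l assume l: "l \<in> L"
    have eq: "{v \<in> {v \<in> V. c v \<in> L}. c v = l} = {v \<in> V. c v = l}" using l by auto
    have "{v \<in> V. c v = l} \<noteq> {}" using l assms by auto
    then have "block_card V c l > 0" using assms by (auto simp: block_card_def card_gt_0_iff)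
    then show "(\<Sum>v\<in>{v \<in> {v \<in> V. c v \<in> L}. c v = l}. 1 / real (block_card V c (c v))) = 1"
      unfolding eq by (simp add: block_card_def)
  qed simp
  finally show ?thesis by simp
qed

text \<open>The count N^(n-2) t_1 ... t_n for n blocks, multiplied by N = \<open>card V\<close> so
  that the exponent n - 1 is right on \<open>nat\<close> also for n = 1.\<close>

theorem weighted_cayley:
  assumes "finite V" "V \<noteq> {}"
  shows "card V * card (trees V c) =
    card V ^ (card (c ` V) - 1) * (\<Prod>l\<in>c ` V. block_card V c l)"
proof (induction "card (c ` V) - 1" arbitrary: c)
  case 0
  moreover have "card (c ` V) > 0" using assms by (simp add: card_gt_0_iff)
  ultimately have "card (c ` V) = 1" by simp
  then obtain l where l: "c ` V = {l}" by (rule card_1_singletonE)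
  then have "trees V c = {{}}" using assms(2) by (intro trees_single_block) simp
  moreover have "{x \<in> V. c x = l} = V" using l by fast
  ultimately show ?case using l by (simp add: block_card_def)
next
  case (Suc n)
  let ?N = "real (card V)" and ?W = "real (\<Prod>l\<in>c ` V. block_card V c l)"
  let ?r = "\<lambda>v. 1 / real (block_card V c (c v))"
  have n: "card (c ` V) - 1 = Suc n" using Suc by simp
  \<comment> \<open>The induction hypothesis applies to the merged labelling, which has one block
    fewer.\<close>
  have step: "?N * real (card (trees V (merge c u v))) = ?N ^ n * ?W * (?r u + ?r v)"
    if uv: "u \<in> V" "v \<in> V" "c v \<noteq> c u" for u v
  proof -
    have img: "merge c u v ` V = c ` V - {c v}" using uv by (intro image_merge) auto
    then have "card (merge c u v ` V) - 1 = n" using n uv assms by (simp add: card_Diff_singleton)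
    then have "card V * card (trees V (merge c u v)) =
        card V ^ n * (\<Prod>l\<in>merge c u v ` V. block_card V (merge c u v) l)"
      using Suc(1)[of "merge c u v"] by simp
    then have "?N * real (card (trees V (merge c u v))) =
        ?N ^ n * real (\<Prod>l\<in>merge c u v ` V. block_card V (merge c u v) l)"
      by (metis of_nat_mult of_nat_power)
    then show ?thesis
      using prod_block_card_merge[OF assms(1) uv(1,2) uv(3)[symmetric]] by (simp add: mult.assoc)
  qed
  have other: "(\<Sum>v\<in>{v \<in> V. c v \<noteq> c u}. ?r v) = real (Suc n)" if "u \<in> V" for u
  proof -
    have "{v \<in> V. c v \<noteq> c u} = {v \<in> V. c v \<in> c ` V - {c u}}" by auto
    then show ?thesis
      using sum_inverse_block_card[OF assms(1), of "c ` V - {c u}" c] that n assms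
      by (simp add: card_Diff_singleton)
  qed
  have right: "(\<Sum>u\<in>V. \<Sum>v\<in>{v \<in> V. c v \<noteq> c u}. ?r v) = ?N * real (Suc n)"
    using other by simp
  \<comment> \<open>Exchanging the sums turns this half of the symmetric double sum into the
    other.\<close>
  have "(\<Sum>u\<in>V. \<Sum>v\<in>{v \<in> V. c v \<noteq> c u}. ?r u) = (\<Sum>v\<in>V. \<Sum>u\<in>{u \<in> V. c v \<noteq> c u}. ?r u)"
    using assms by (intro sum.swap_restrict)
  also have "\<dots> = (\<Sum>v\<in>V. \<Sum>u\<in>{u \<in> V. c u \<noteq> c v}. ?r u)"
    by (intro sum.cong refl) auto
  finally have left: "(\<Sum>u\<in>V. \<Sum>v\<in>{v \<in> V. c v \<noteq> c u}. ?r u) = ?N * real (Suc n)"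
    using right by simp
  have "2 * real (Suc n) * (?N * real (card (trees V c))) =
      ?N * real (2 * (card (c ` V) - 1) * card (trees V c))" unfolding n by (simp add: algebra_simps)
  also have "\<dots> = (\<Sum>u\<in>V. \<Sum>v\<in>{v \<in> V. c v \<noteq> c u}. ?N * real (card (trees V (merge c u v))))"
    unfolding sum_card_trees_merge[OF assms] by (simp add: sum_distrib_left)
  also have "\<dots> = (\<Sum>u\<in>V. \<Sum>v\<in>{v \<in> V. c v \<noteq> c u}. ?N ^ n * ?W * (?r u + ?r v))"
    using step by (intro sum.cong refl) auto
  also have "\<dots> = ?N ^ n * ?W * ((\<Sum>u\<in>V. \<Sum>v\<in>{v \<in> V. c v \<noteq> c u}. ?r u) +
      (\<Sum>u\<in>V. \<Sum>v\<in>{v \<in> V. c v \<noteq> c u}. ?r v))"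
    by (simp add: distrib_left sum.distrib sum_distrib_left mult_ac)
  also have "\<dots> = 2 * real (Suc n) * (?N ^ Suc n * ?W)"
    unfolding left right by (simp add: algebra_simps)
  finally have "?N * real (card (trees V c)) = ?N ^ Suc n * ?W" by simp
  then have "real (card V * card (trees V c)) =
      real (card V ^ Suc n * (\<Prod>l\<in>c ` V. block_card V c l))" by simp
  then show ?case unfolding n by (simp only: of_nat_eq_iff)
qed

section \<open>Binomial ideals and congruences of monomials\<close>

text \<open>The reflexive transitive closure is already an equivalence, because unordered edges make
  the generating steps symmetric. The shift by \<open>w\<close> is multiplication by a
  monomial.\<close>

definition monom_cong :: "'m monom set set \<Rightarrow> ('m monom \<times> 'm monom) set" where
  "monom_cong E = {(p + w, q + w) | p q w. {p, q} \<in> E}\<^sup>*"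

text \<open>Edges forget the sign. The zero binomial is x^u - x^u for every \<open>u\<close>, so if
  it lies in \<open>S\<close>, all loops \<open>{u}\<close> appear.\<close>

definition binomial_edges :: "('m, 'k::comm_ring_1) mpoly set \<Rightarrow> 'm monom set set" where
  "binomial_edges S = {{u, v} | u v. x_pow u - x_pow v \<in> S}"

section \<open>Rules for congruences of monomials\<close>

lemma monom_cong_translate: "{p, q} \<in> E \<Longrightarrow> (p + w, q + w) \<in> monom_cong E"
  unfolding monom_cong_def
  by (rule r_into_rtrancl, rule CollectI, rule exI[of _ p], rule exI[of _ q], rule exI[of _ w]) simp

lemma monom_cong_edge: "{p, q} \<in> E \<Longrightarrow> (p, q) \<in> monom_cong E"
  using monom_cong_translate[of p q E 0] by simp

lemma monom_cong_refl: "(u, u) \<in> monom_cong E"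
  by (simp add: monom_cong_def)

lemma monom_cong_trans: "(u, v) \<in> monom_cong E \<Longrightarrow> (v, w) \<in> monom_cong E \<Longrightarrow> (u, w) \<in> monom_cong E"
  unfolding monom_cong_def by (rule rtrancl_trans)

lemma monom_cong_induct [consumes 1, case_names refl step]:
  assumes "(u, v) \<in> monom_cong E"
    and "R u u"
    and "\<And>p q w. (u, p + w) \<in> monom_cong E \<Longrightarrow> R u (p + w) \<Longrightarrow> {p, q} \<in> E \<Longrightarrow> R u (q + w)"
  shows "R u v"
  using assms(1) unfolding monom_cong_def
proof (induction rule: rtrancl_induct)
  case (step y z)
  then show ?case using assms(3) unfolding monom_cong_def by blast
qed (rule assms(2))

lemma monom_cong_sym: "(u, v) \<in> monom_cong E \<Longrightarrow> (v, u) \<in> monom_cong E"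
proof (induction rule: monom_cong_induct)
  case (step p q w)
  have "{q, p} \<in> E" using step.hyps(2) by (subst insert_commute)
  then show ?case using step.IH by (rule monom_cong_trans[OF monom_cong_translate])
qed (rule monom_cong_refl)

lemma monom_cong_add:
  assumes "(u, v) \<in> monom_cong E"
  shows "(u + w, v + w) \<in> monom_cong E"
  using assms
proof (induction rule: monom_cong_induct)
  case (step p q x)
  have "(p + (x + w), q + (x + w)) \<in> monom_cong E" using step.hyps(2) by (rule monom_cong_translate)
  then show ?case using step.IH by (simp only: add.assoc monom_cong_trans)
qed (rule monom_cong_refl)

text \<open>The larger congruence absorbs translations and chains, so only generators have to be
  checked.\<close>

lemma monom_cong_subset:
  assumes "\<And>p q. {p, q} \<in> E \<Longrightarrow> (p, q) \<in> monom_cong E'"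
  shows "monom_cong E \<subseteq> monom_cong E'"
proof (rule subrelI)
  fix u v assume "(u, v) \<in> monom_cong E"
  then show "(u, v) \<in> monom_cong E'"
  proof (induction rule: monom_cong_induct)
    case (step p q w)
    have "(p + w, q + w) \<in> monom_cong E'" using step.hyps(2) by (intro monom_cong_add assms)
    then show ?case using step.IH by (rule monom_cong_trans[rotated])
  qed (rule monom_cong_refl)
qed

lemma monom_cong_mono: "E \<subseteq> E' \<Longrightarrow> monom_cong E \<subseteq> monom_cong E'"
  by (rule monom_cong_subset) (blast intro: monom_cong_edge)

section \<open>Membership of binomials in binomial ideals\<close>

lemma x_pow_add: "x_pow (u + v) = x_pow u * x_pow v"
  by (simp add: x_pow_def mult_single)

lemma x_pow_eq_iff: "(x_pow u :: ('m, 'k::comm_ring_1) mpoly) = x_pow v \<longleftrightarrow> u = v"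
  by (metis inj_single lookup_single_eq lookup_single_not_eq x_pow_def zero_neq_one)

interpretation ring_module: module "(*) :: 'r::comm_ring_1 \<Rightarrow> 'r \<Rightarrow> 'r"
  by (rule module_times)

lemma ideal_gen_mult: "f \<in> ideal_gen S \<Longrightarrow> g * f \<in> ideal_gen S"
  unfolding ideal_gen_def by (rule ring_module.span_scale)

lemma ideal_gen_base: "f \<in> S \<Longrightarrow> f \<in> ideal_gen S"
  unfolding ideal_gen_def by (rule ring_module.span_base)

lemma ideal_gen_subset: "ideal_gen S \<subseteq> ideal_gen T \<longleftrightarrow> S \<subseteq> ideal_gen T"
  unfolding ideal_gen_def
  by (metis ring_module.span_mono ring_module.span_span ring_module.span_superset subset_trans)

text \<open>A linear functional used to refute membership: if \<open>C\<close> is a union of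
  congruence classes, it vanishes on the ideal.\<close>

definition class_sum :: "'m monom set \<Rightarrow> ('m, 'k::comm_ring_1) mpoly \<Rightarrow> 'k" where
  "class_sum C f = (\<Sum>k\<in>Poly_Mapping.keys f. Poly_Mapping.lookup f k when k \<in> C)"

lemma class_sum_add: "class_sum C (f + g) = class_sum C f + class_sum C g"
  unfolding class_sum_def by (rule setsum_keys_plus_distrib) (simp_all add: when_def)

lemma class_sum_single: "class_sum C (Poly_Mapping.single u c) = (c when u \<in> C)"
  by (simp add: class_sum_def when_def)

lemma class_sum_0: "class_sum C 0 = 0"
  by (simp add: class_sum_def)

lemma class_sum_diff: "class_sum C (f - g) = class_sum C f - class_sum C g"
  using class_sum_add[of C "f - g" g] by simp

text \<open>Each term of \<open>f\<close> is shifted by \<open>u\<close> and by \<open>v\<close>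
  either both times into \<open>C\<close> or both times out of it, and the two contributions
  cancel.\<close>

lemma class_sum_mult_binomial:
  assumes "\<And>w. u + w \<in> C \<longleftrightarrow> v + w \<in> C"
  shows "class_sum C (f * (x_pow u - x_pow v)) = 0"
proof (induction f rule: update_induct)
  case const
  then show ?case by (simp add: class_sum_0)
next
  case (update f w c)
  have "Poly_Mapping.update w c f = f + Poly_Mapping.single w c"
    using update(1) by (intro poly_mapping_eqI)
      (auto simp: lookup_update lookup_add lookup_single when_def not_in_keys_iff_lookup_eq_zero)
  moreover have "class_sum C (Poly_Mapping.single w c * (x_pow u - x_pow v)) = 0"
    using assms[of w]
    by (simp add: right_diff_distrib class_sum_diff x_pow_def mult_single class_sum_single add.commute)
  ultimately show ?case using update(3) by (simp add: distrib_right class_sum_add)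
qed

lemma class_sum_ideal_gen:
  assumes "f \<in> ideal_gen S" "\<forall>f\<in>S. is_binomial f"
    and "\<And>u v. (u, v) \<in> monom_cong (binomial_edges S) \<Longrightarrow> u \<in> C \<longleftrightarrow> v \<in> C"
  shows "class_sum C f = 0"
  using assms(1) unfolding ideal_gen_def
proof (induction rule: ring_module.span_induct_alt)
  case base
  show ?case by (rule class_sum_0)
next
  case (step c x y)
  obtain u v where x: "x = x_pow u - x_pow v" using step(1) assms(2) by (auto simp: is_binomial_def)
  have "{u, v} \<in> binomial_edges S" using step(1) x by (auto simp: binomial_edges_def)
  then have "class_sum C (c * x) = 0"
    unfolding x using assms(3) by (intro class_sum_mult_binomial) (blast intro: monom_cong_edge monom_cong_add)
  then show ?case using step(2) by (simp add: class_sum_add)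
qed

text \<open>From congruence to ideal, the multiples of generators along a chain telescope.
  Conversely, \<open>class_sum\<close> over the class of \<open>u\<close> vanishes on the ideal, but
  takes the value 1 on x^u - x^v unless \<open>v\<close> lies in that class.\<close>

lemma binomial_in_ideal_gen_iff:
  fixes S :: "('m, 'k::comm_ring_1) mpoly set"
  assumes "\<forall>f\<in>S. is_binomial f"
  shows "x_pow u - x_pow v \<in> ideal_gen S \<longleftrightarrow> (u, v) \<in> monom_cong (binomial_edges S)"
proof
  assume "(u, v) \<in> monom_cong (binomial_edges S)"
  then show "x_pow u - x_pow v \<in> ideal_gen S"
  proof (induction rule: monom_cong_induct)
    case refl
    then show ?case by (simp add: ideal_gen_def ring_module.span_zero)
  next
    case (step p q w)
    obtain p' q' where pq: "{p, q} = {p', q'}" "x_pow p' - x_pow q' \<in> S"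
      using step.hyps(2) by (auto simp: binomial_edges_def)
    \<comment> \<open>The unordered edge may come from either sign of the binomial.\<close>
    then have "x_pow p - x_pow q \<in> S \<or> - (x_pow p - x_pow q) \<in> S"
      by (auto simp: doubleton_eq_iff)
    then have "x_pow p - x_pow q \<in> ideal_gen S"
      unfolding ideal_gen_def by (metis ring_module.span_base ring_module.span_neg minus_minus)
    then have "x_pow w * (x_pow p - x_pow q) \<in> ideal_gen S" by (rule ideal_gen_mult)
    then have "(x_pow u - x_pow (p + w)) + x_pow w * (x_pow p - x_pow q) \<in> ideal_gen S"
      using step.IH unfolding ideal_gen_def by (intro ring_module.span_add)
    then show ?case by (simp add: x_pow_add algebra_simps)
  qed
next
  assume *: "x_pow u - x_pow v \<in> ideal_gen S"
  define C where "C = {w. (u, w) \<in> monom_cong (binomial_edges S)}"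
  have "class_sum C (x_pow u - x_pow v :: ('m, 'k) mpoly) = 0"
    using * assms unfolding C_def by (rule class_sum_ideal_gen) (blast intro: monom_cong_trans monom_cong_sym)
  then have "v \<in> C"
    by (auto simp: class_sum_diff x_pow_def class_sum_single C_def monom_cong_refl when_def split: if_splits)
  then show "(u, v) \<in> monom_cong (binomial_edges S)" by (simp add: C_def)
qed

section \<open>Degrees and fibres\<close>

lemma deg_A_add: "deg_A a (u + v) = deg_A a u + deg_A a v"
  by (simp add: deg_A_def lookup_add vector_sadd_rdistrib sum.distrib)

lemma deg_A_0: "deg_A a 0 = 0"
  by (simp add: deg_A_def)

lemma deg_A_single: "deg_A a (Poly_Mapping.single i k) = int k *s a i"
proof -
  have "int (Poly_Mapping.lookup (Poly_Mapping.single i k) j) *s a j = (if j = i then int k *s a i else 0)" for j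
    by (simp add: lookup_single when_def)
  then show ?thesis by (simp add: deg_A_def)
qed

lemma NA_eq_range: "NA a = range (deg_A a)"
proof -
  have "(\<Sum>i\<in>UNIV. int (l i) *s a i) = deg_A a (Abs_poly_mapping l)" for l
    by (simp add: deg_A_def)
  then have "NA a \<subseteq> range (deg_A a)" unfolding NA_def by blast
  moreover have "range (deg_A a) \<subseteq> NA a" unfolding NA_def deg_A_def by blast
  ultimately show ?thesis by blast
qed

lemma deg_A_in_NA: "deg_A a u \<in> NA a"
  by (simp add: NA_eq_range)

lemma pointed_deg_A:
  assumes "pointed (NA a)" "deg_A a u + deg_A a v = 0"
  shows "deg_A a u = 0"
proof -
  have "- deg_A a u = deg_A a v" using assms(2) by (simp add: minus_unique)
  then show ?thesis using assms(1) unfolding pointed_def by (metis deg_A_in_NA)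
qed

lemma less_NA_iff: "less_NA a d b \<longleftrightarrow> (\<exists>w. b = d + deg_A a w \<and> deg_A a w \<noteq> 0)"
  by (auto simp: less_NA_def le_NA_def NA_eq_range)

lemma monom_cong_deg_A:
  assumes "(u, v) \<in> monom_cong E" "\<And>p q. {p, q} \<in> E \<Longrightarrow> deg_A a p = deg_A a q"
  shows "deg_A a u = deg_A a v"
  using assms(1)
proof (induction rule: monom_cong_induct)
  case (step p q w)
  then show ?case using assms(2)[of p q] by (simp add: deg_A_add)
qed simp

section \<open>Toric ideals as congruences\<close>

definition deg_edges :: "('m::finite \<Rightarrow> int ^ 'n) \<Rightarrow> 'm monom set set" where
  "deg_edges a = {{u, v} | u v. deg_A a u = deg_A a v}"

definition edges_below :: "('m::finite \<Rightarrow> int ^ 'n) \<Rightarrow> int ^ 'n \<Rightarrow> 'm monom set set" where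
  "edges_below a b = {{u, v} | u v. deg_A a u = deg_A a v \<and> less_NA a (deg_A a u) b}"

lemma doubleton_in_iff:
  assumes "\<And>u v. R u v \<Longrightarrow> R v u"
  shows "{p, q} \<in> {{u, v} | u v. R u v} \<longleftrightarrow> R p q"
proof
  assume "{p, q} \<in> {{u, v} | u v. R u v}"
  then obtain u v where "{p, q} = {u, v}" "R u v" by blast
  then show "R p q" using assms unfolding doubleton_eq_iff by blast
qed blast

lemma deg_edges_iff: "{p, q} \<in> deg_edges a \<longleftrightarrow> deg_A a p = deg_A a q"
  unfolding deg_edges_def by (rule doubleton_in_iff) simp

lemma edges_below_iff:
  "{p, q} \<in> edges_below a b \<longleftrightarrow> deg_A a p = deg_A a q \<and> less_NA a (deg_A a p) b"
  unfolding edges_below_def by (rule doubleton_in_iff) metis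

lemma monom_cong_deg_edges: "(u, v) \<in> monom_cong (deg_edges a) \<longleftrightarrow> deg_A a u = deg_A a v"
proof
  show "(u, v) \<in> monom_cong (deg_edges a) \<Longrightarrow> deg_A a u = deg_A a v"
    by (erule monom_cong_deg_A) (rule deg_edges_iff[THEN iffD1])
  show "deg_A a u = deg_A a v \<Longrightarrow> (u, v) \<in> monom_cong (deg_edges a)"
    by (intro monom_cong_edge deg_edges_iff[THEN iffD2])
qed

text \<open>For \<open>u \<noteq> v\<close> the coefficients at \<open>u\<close> and
  \<open>v\<close> are 1 and -1, hence nonzero, which recovers both exponents. Their order stays
  open, as 1 and -1 can coincide; the second alternative is the zero binomial.\<close>

lemma x_pow_diff_eqD:
  assumes "(x_pow u - x_pow v :: ('m, 'k::comm_ring_1) mpoly) = x_pow u' - x_pow v'"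
  shows "{u, v} = {u', v'} \<or> u = v \<and> u' = v'"
proof (cases "u = v")
  case True
  then show ?thesis using assms by (metis eq_iff_diff_eq_0 x_pow_eq_iff)
next
  case False
  have lk: "Poly_Mapping.lookup (x_pow p - x_pow q :: ('m, 'k) mpoly) k =
      (1 when p = k) - (1 when q = k)" for p q k
    by (simp add: lookup_minus x_pow_def lookup_single)
  have "(1 when u' = u) - (1 when v' = u) = (1 :: 'k)"
    using lk[of u v u] lk[of u' v' u] assms False by simp
  then have "u \<in> {u', v'}" by (auto simp: when_def split: if_splits)
  moreover have "(1 when u' = v) - (1 when v' = v) = (- 1 :: 'k)"
    using lk[of u v v] lk[of u' v' v] assms False by simp
  then have "v \<in> {u', v'}" by (auto simp: when_def split: if_splits)
  ultimately show ?thesis using False by auto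
qed

text \<open>The edge sets can differ by loops, as the zero binomial has many representations, but
  loops do not affect the congruence.\<close>

lemma monom_cong_binomial_edges_diff:
  assumes "\<And>u v. R u v \<Longrightarrow> R v u"
  shows "monom_cong (binomial_edges {x_pow u - x_pow v :: ('m, 'k::comm_ring_1) mpoly | u v. R u v}) =
    monom_cong {{u, v} | u v. R u v}" (is "monom_cong ?E = monom_cong ?F")
proof (rule equalityI; rule monom_cong_subset)
  fix p q assume "{p, q} \<in> ?E"
  then obtain p' q' u v where *: "{p, q} = {p', q'}" "R u v"
    "x_pow p' - x_pow q' = (x_pow u - x_pow v :: ('m, 'k) mpoly)"
    unfolding binomial_edges_def by blast
  from x_pow_diff_eqD[OF *(3)] show "(p, q) \<in> monom_cong ?F"
  proof
    assume "{p', q'} = {u, v}"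
    with *(1) have "{p, q} = {u, v}" by (rule trans)
    moreover have "{u, v} \<in> ?F" using *(2) by blast
    ultimately show ?thesis by (intro monom_cong_edge) simp
  next
    assume "p' = q' \<and> u = v"
    then have "p = q" using *(1) by auto
    then show ?thesis by (simp add: monom_cong_refl)
  qed
next
  fix p q assume "{p, q} \<in> ?F"
  then have "R p q" using doubleton_in_iff[of R p q] assms by blast
  then have "{p, q} \<in> ?E" unfolding binomial_edges_def by blast
  then show "(p, q) \<in> monom_cong ?E" by (rule monom_cong_edge)
qed

lemma binomial_in_toric_ideal_iff:
  "x_pow u - x_pow v \<in> (toric_ideal a :: ('m::finite, 'k::field) mpoly set) \<longleftrightarrow>
    deg_A a u = deg_A a v"
  unfolding toric_ideal_def
proof (subst binomial_in_ideal_gen_iff)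
  show "(u, v) \<in> monom_cong (binomial_edges {x_pow u - x_pow v :: ('m, 'k) mpoly |u v. deg_A a u = deg_A a v})
      \<longleftrightarrow> deg_A a u = deg_A a v"
    by (subst monom_cong_binomial_edges_diff) (simp_all flip: deg_edges_def add: monom_cong_deg_edges)
qed (auto simp: is_binomial_def)

text \<open>The field has disappeared from the right-hand side: the graphs \<open>G(b)\<close> are
  the same over every field.\<close>

lemma binomial_in_toric_ideal_below_iff:
  "x_pow u - x_pow v \<in> (toric_ideal_below a b :: ('m::finite, 'k::field) mpoly set) \<longleftrightarrow>
    (u, v) \<in> monom_cong (edges_below a b)"
  unfolding toric_ideal_below_def
proof (subst binomial_in_ideal_gen_iff)
  show "(u, v) \<in> monom_cong (binomial_edges {x_pow u - x_pow v :: ('m, 'k) mpoly |u v.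
        deg_A a u = deg_A a v \<and> less_NA a (deg_A a u) b}) \<longleftrightarrow> (u, v) \<in> monom_cong (edges_below a b)"
    by (subst monom_cong_binomial_edges_diff) (metis, simp flip: edges_below_def)
qed (auto simp: is_binomial_def)

section \<open>Dickson's lemma\<close>

lemma nat_mono_subseq:
  fixes s :: "nat \<Rightarrow> nat"
  shows "\<exists>r :: nat \<Rightarrow> nat. strict_mono r \<and> mono (\<lambda>n. s (r n))"
proof -
  obtain f where f: "strict_mono f" "monoseq (\<lambda>n. s (f n))" using seq_monosub[of s] by blast
  show ?thesis
  proof (cases "\<forall>m. \<forall>n\<ge>m. s (f m) \<le> s (f n)")
    case True
    then show ?thesis using f by (intro exI[of _ f]) (auto simp: mono_def)
  next
    case False
    \<comment> \<open>The sequence is now non-increasing, hence constant from a place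
      \<open>N\<close> of its minimum on.\<close>
    then have dec: "s (f n) \<le> s (f m)" if "m \<le> n" for m n
      using f(2) that by (auto simp: monoseq_def)
    obtain N where N: "s (f N) \<le> s (f n)" for n
      using ex_has_least_nat[of "\<lambda>_. True" 0 "\<lambda>n. s (f n)"] by auto
    have "s (f (n + N)) = s (f N)" for n
      using N[of "n + N"] dec[of N "n + N"] by simp
    moreover have "strict_mono (\<lambda>n. f (n + N))"
      using f(1) by (simp add: strict_mono_def)
    ultimately show ?thesis by (intro exI[of _ "\<lambda>n. f (n + N)"]) (simp add: mono_def)
  qed
qed

text \<open>Coordinates are treated one after the other; passing to a further subsequence keeps the
  earlier ones monotone.\<close>

lemma dickson_subseq:
  fixes f :: "nat \<Rightarrow> 'i \<Rightarrow> nat"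
  assumes "finite I"
  shows "\<exists>r :: nat \<Rightarrow> nat. strict_mono r \<and> (\<forall>i\<in>I. mono (\<lambda>n. f (r n) i))"
  using assms
proof (induction I)
  case empty
  show ?case by (intro exI[of _ id]) (simp add: strict_mono_def)
next
  case (insert i I)
  then obtain r :: "nat \<Rightarrow> nat" where r: "strict_mono r" "\<forall>i\<in>I. mono (\<lambda>n. f (r n) i)" by blast
  obtain q :: "nat \<Rightarrow> nat" where q: "strict_mono q" "mono (\<lambda>n. f (r (q n)) i)"
    using nat_mono_subseq[of "\<lambda>n. f (r n) i"] by blast
  have "mono q" by (rule strict_mono_mono[OF q(1)])
  then have "mono (\<lambda>n. f (r (q n)) j)" if "j \<in> I" for j
    using r(2) that by (auto simp: mono_def)
  moreover have "strict_mono (\<lambda>n. r (q n))" using r(1) q(1) by (simp add: strict_mono_def)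
  ultimately show ?case using q(2) by blast
qed

lemma dickson:
  fixes A :: "('i::finite \<Rightarrow> nat) set"
  assumes "infinite A"
  shows "\<exists>u\<in>A. \<exists>v\<in>A. u \<noteq> v \<and> u \<le> v"
proof -
  obtain f :: "nat \<Rightarrow> 'i \<Rightarrow> nat" where f: "inj f" "range f \<subseteq> A"
    using infinite_countable_subset[OF assms] by blast
  obtain r :: "nat \<Rightarrow> nat" where r: "strict_mono r" "\<forall>i\<in>UNIV. mono (\<lambda>n. f (r n) i)"
    using dickson_subseq[OF finite[of UNIV], of f] by blast
  have "f (r 0) \<le> f (r 1)" using r(2) by (auto simp: le_fun_def mono_def)
  moreover have "f (r 0) \<noteq> f (r 1)"
    using f(1) r(1) by (metis inj_eq strict_mono_eq zero_neq_one)
  ultimately show ?thesis using f(2) by blast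
qed

text \<open>Minimal elements are pairwise incomparable, hence finite in number by
  \<open>dickson\<close>. Below each \<open>x\<close> there is one: a member of least coordinate
  sum.\<close>

lemma dickson_basis:
  fixes A :: "('i::finite \<Rightarrow> nat) set"
  shows "\<exists>M\<subseteq>A. finite M \<and> (\<forall>x\<in>A. \<exists>m\<in>M. m \<le> x)"
proof -
  define M where "M = {x \<in> A. \<forall>y\<in>A. y \<le> x \<longrightarrow> y = x}"
  have "finite M" using dickson[of M] by (auto simp: M_def)
  moreover have "\<exists>m\<in>M. m \<le> x" if x: "x \<in> A" for x
  proof -
    obtain m where m: "m \<in> A" "m \<le> x" "\<And>y. y \<in> A \<Longrightarrow> y \<le> x \<Longrightarrow> sum m UNIV \<le> sum y UNIV"
      using ex_has_least_nat[of "\<lambda>y. y \<in> A \<and> y \<le> x" x "\<lambda>y. sum y UNIV"] x by auto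
    have "y = m" if y: "y \<in> A" "y \<le> m" for y
    proof (rule ccontr)
      assume "y \<noteq> m"
      then obtain i where "y i < m i" using y(2) by (metis ext le_funD le_neq_implies_less)
      then have "sum y UNIV < sum m UNIV" using y(2) by (intro sum_strict_mono_ex1) (auto simp: le_fun_def)
      then show False using m(3)[of y] y m(2) by fastforce
    qed
    then show ?thesis using m by (auto simp: M_def)
  qed
  ultimately show ?thesis by (intro exI[of _ M]) (auto simp: M_def)
qed

lemma monom_le_add:
  fixes u v :: "'m monom"
  assumes "Poly_Mapping.lookup u \<le> Poly_Mapping.lookup v"
  shows "v = u + (v - u)"
  using assms by (intro poly_mapping_eqI) (simp add: lookup_add lookup_minus le_fun_def)

text \<open>Such an \<open>M\<close> generates the monoid of pairs of monomials of equal degree: the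
  remainder \<open>(u', v')\<close> has equal degrees again and, as \<open>(0, 0)\<close> is
  excluded from \<open>M\<close>, is smaller.\<close>

definition degree_basis ::
    "('m::finite \<Rightarrow> int ^ 'n) \<Rightarrow> ('m monom \<times> 'm monom) set \<Rightarrow> bool" where
  "degree_basis a M \<longleftrightarrow> (\<forall>p q. (p, q) \<in> M \<longrightarrow> deg_A a p = deg_A a q \<and> (p \<noteq> 0 \<or> q \<noteq> 0)) \<and>
     (\<forall>u v. deg_A a u = deg_A a v \<longrightarrow> u \<noteq> 0 \<or> v \<noteq> 0 \<longrightarrow>
       (\<exists>p q u' v'. (p, q) \<in> M \<and> u = p + u' \<and> v = q + v'))"

text \<open>\<open>dickson_basis\<close> is applied to pairs written as exponent vectors over the
  sum of two copies of the index type.\<close>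

lemma ex_degree_basis:
  fixes a :: "'m::finite \<Rightarrow> int ^ 'n"
  obtains M where "finite M" "degree_basis a M"
proof -
  define L where "L = {(u, v). deg_A a u = deg_A a v \<and> (u \<noteq> 0 \<or> v \<noteq> 0)}"
  define g :: "'m monom \<times> 'm monom \<Rightarrow> 'm + 'm \<Rightarrow> nat"
    where "g = (\<lambda>(u, v). case_sum (Poly_Mapping.lookup u) (Poly_Mapping.lookup v))"
  have "inj g"
  proof (rule injI)
    fix x y assume "g x = g y"
    then have "g x (Inl i) = g y (Inl i)" "g x (Inr i) = g y (Inr i)" for i by simp_all
    then show "x = y" by (auto simp: g_def split_def intro!: prod_eqI poly_mapping_eqI)
  qed
  obtain M where M: "M \<subseteq> g ` L" "finite M" "\<forall>x\<in>g ` L. \<exists>m\<in>M. m \<le> x"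
    using dickson_basis[of "g ` L"] by blast
  show thesis
  proof (rule that[of "g -` M"])
    show "finite (g -` M)" using M(2) \<open>inj g\<close> by (rule finite_vimageI)
    have sub: "g -` M \<subseteq> L"
    proof
      fix x assume "x \<in> g -` M"
      then have "g x \<in> g ` L" using M(1) by blast
      then show "x \<in> L" using \<open>inj g\<close> by (simp add: inj_image_mem_iff)
    qed
    show "degree_basis a (g -` M)"
      unfolding degree_basis_def
    proof (intro conjI allI impI)
      fix p q assume "(p, q) \<in> g -` M"
      then have "(p, q) \<in> L" using sub by blast
      then show "deg_A a p = deg_A a q" "p \<noteq> 0 \<or> q \<noteq> 0" by (simp_all add: L_def)
    next
      fix u v assume "deg_A a u = deg_A a v" "u \<noteq> 0 \<or> v \<noteq> 0"
      then have "(u, v) \<in> L" by (simp add: L_def)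
      then obtain m where m: "m \<in> M" "m \<le> g (u, v)" using M(3) by blast
      then obtain p q where pq: "m = g (p, q)" using M(1) by auto
      have "g (p, q) (Inl i) \<le> g (u, v) (Inl i)" "g (p, q) (Inr i) \<le> g (u, v) (Inr i)" for i
        using m(2) pq by (simp_all add: le_fun_def)
      then have "u = p + (u - p)" "v = q + (v - q)"
        by (intro monom_le_add; simp add: g_def le_fun_def)+
      then show "\<exists>p q u' v'. (p, q) \<in> g -` M \<and> u = p + u' \<and> v = q + v'"
        using m(1) pq by (intro exI[of _ p] exI[of _ q] exI[of _ "u - p"] exI[of _ "v - q"]) simp
    qed
  qed
qed

section \<open>Chains made of basis pairs\<close>

definition monom_size :: "'m::finite monom \<Rightarrow> nat" where
  "monom_size u = (\<Sum>i\<in>UNIV. Poly_Mapping.lookup u i)"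

lemma monom_size_add: "monom_size (u + v) = monom_size u + monom_size v"
  by (simp add: monom_size_def lookup_add sum.distrib)

lemma monom_size_eq_0: "monom_size u = 0 \<longleftrightarrow> u = 0"
  by (auto simp: monom_size_def intro: poly_mapping_eqI)

definition basis_edges :: "('m monom \<times> 'm monom) set \<Rightarrow> 'm monom \<Rightarrow> 'm monom set set" where
  "basis_edges M u = {e. \<exists>p q w. (p, q) \<in> M \<and> u = p + w \<and> e = {p, q}}"

lemma basis_edges_add: "basis_edges M u \<subseteq> basis_edges M (v + u)"
  unfolding basis_edges_def by (intro Collect_mono impI; elim exE conjE) (metis add.left_commute)

text \<open>Split off a basis pair, \<open>u = p + u'\<close> and \<open>v = q + v'\<close>. The
  chain runs from \<open>p + u'\<close> to \<open>p + v'\<close> by induction on the total size,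
  then by one edge to \<open>q + v'\<close>.\<close>

lemma monom_cong_basis:
  fixes a :: "'m::finite \<Rightarrow> int ^ 'n"
  assumes M: "degree_basis a M" and "deg_A a u = deg_A a v"
  shows "(u, v) \<in> monom_cong (basis_edges M u)"
  using assms(2)
proof (induction "monom_size u + monom_size v" arbitrary: u v rule: less_induct)
  case less
  show ?case
  proof (cases "u = 0 \<and> v = 0")
    case True
    then show ?thesis by (simp add: monom_cong_refl)
  next
    case False
    then obtain p q u' v' where pq: "(p, q) \<in> M" "u = p + u'" "v = q + v'"
      using M less.prems unfolding degree_basis_def by meson
    have "deg_A a p = deg_A a q" "p \<noteq> 0 \<or> q \<noteq> 0"
      using M pq(1) unfolding degree_basis_def by blast+
    moreover from this have "0 < monom_size p + monom_size q" using monom_size_eq_0 by auto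
    ultimately have "(u', v') \<in> monom_cong (basis_edges M u')"
      using less.prems by (intro less.hyps) (simp_all add: pq(2,3) monom_size_add deg_A_add)
    then have "(u', v') \<in> monom_cong (basis_edges M u)"
      using monom_cong_mono[OF basis_edges_add] pq(2) by blast
    then have "(u' + p, v' + p) \<in> monom_cong (basis_edges M u)" by (rule monom_cong_add)
    moreover have "{p, q} \<in> basis_edges M u" using pq unfolding basis_edges_def by blast
    then have "(p + v', q + v') \<in> monom_cong (basis_edges M u)" by (rule monom_cong_translate)
    ultimately show ?thesis using pq by (metis add.commute monom_cong_trans)
  qed
qed

section \<open>Finite fibres and induction along the order of degrees\<close>

lemma deg_A_eq_0D:
  assumes "pointed (NA a)" "\<And>i. a i \<noteq> 0" "deg_A a w = 0"
  shows "w = 0"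
proof (rule poly_mapping_eqI, rule ccontr)
  fix i assume "Poly_Mapping.lookup w i \<noteq> Poly_Mapping.lookup 0 i"
  \<comment> \<open>If x_i divides \<open>w\<close>, the degree of the cofactor is inverse to that
    of x_i.\<close>
  then have "w = Poly_Mapping.single i 1 + (w - Poly_Mapping.single i 1)"
    by (intro monom_le_add) (auto simp: le_fun_def lookup_single when_def)
  then have "deg_A a (Poly_Mapping.single i 1) + deg_A a (w - Poly_Mapping.single i 1) = 0"
    using assms(3) by (metis deg_A_add)
  then have "deg_A a (Poly_Mapping.single i 1) = 0" using assms(1) by (rule pointed_deg_A[rotated])
  then show False using assms(2) by (simp add: deg_A_single)
qed

text \<open>By \<open>dickson\<close> an infinite fibre contains a monomial properly dividing
  another one, and the quotient would be a nontrivial monomial of degree 0.\<close>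

lemma finite_G_verts:
  assumes "pointed (NA a)" "\<And>i. a i \<noteq> 0"
  shows "finite (G_verts a b)"
proof (rule ccontr)
  assume "infinite (G_verts a b)"
  moreover have "inj_on Poly_Mapping.lookup (G_verts a b)" by (auto intro: inj_onI poly_mapping_eqI)
  ultimately have "infinite (Poly_Mapping.lookup ` G_verts a b)" using finite_imageD by blast
  from dickson[OF this] obtain u v where uv: "u \<in> G_verts a b" "v \<in> G_verts a b" "u \<noteq> v"
    "Poly_Mapping.lookup u \<le> Poly_Mapping.lookup v" by blast
  have v: "v = u + (v - u)" using uv(4) by (rule monom_le_add)
  then have "deg_A a (v - u) = 0" using uv(1,2) unfolding G_verts_def
    by (metis (mono_tags) add_cancel_left_right deg_A_add mem_Collect_eq)
  then have "v - u = 0" using assms by (intro deg_A_eq_0D)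
  then show False using v uv(3) by simp
qed

text \<open>A rank for induction along the strict order on degrees. \<open>Max\<close> is meaningful
  here only for finite nonempty fibres.\<close>

definition height :: "('m::finite \<Rightarrow> int ^ 'n) \<Rightarrow> int ^ 'n \<Rightarrow> nat" where
  "height a b = Max (monom_size ` G_verts a b)"

text \<open>A largest monomial of degree \<open>d\<close>, multiplied by a monomial of nonzero
  degree, is a larger monomial in the fibre of \<open>b\<close>.\<close>

lemma height_less:
  assumes "pointed (NA a)" "\<And>i. a i \<noteq> 0" "d \<in> NA a" "less_NA a d b"
  shows "height a d < height a b"
proof -
  have "G_verts a d \<noteq> {}" using assms(3) by (auto simp: G_verts_def NA_eq_range)
  then have "height a d \<in> monom_size ` G_verts a d"
    unfolding height_def using finite_G_verts[OF assms(1,2)] by (intro Max_in) auto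
  then obtain u where u: "u \<in> G_verts a d" "height a d = monom_size u" by blast
  obtain w where w: "b = d + deg_A a w" "deg_A a w \<noteq> 0" using assms(4) less_NA_iff by blast
  have "u + w \<in> G_verts a b" using u w by (simp add: G_verts_def deg_A_add)
  then have "monom_size (u + w) \<le> height a b"
    unfolding height_def using finite_G_verts[OF assms(1,2)] by (intro Max_ge) auto
  moreover have "monom_size w \<noteq> 0" using w(2) by (auto simp: monom_size_eq_0 deg_A_0)
  ultimately show ?thesis using u(2) by (simp add: monom_size_add)
qed

section \<open>The components of the graphs \<open>G(b)\<close>\<close>

definition fibre_comp :: "('m::finite \<Rightarrow> int ^ 'n) \<Rightarrow> int ^ 'n \<Rightarrow> 'm monom \<Rightarrow> 'm monom set" where
  "fibre_comp a b u = {v \<in> G_verts a b. (u, v) \<in> monom_cong (edges_below a b)}"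

lemma fibre_comp_eq_iff:
  assumes "u \<in> G_verts a b" "v \<in> G_verts a b"
  shows "fibre_comp a b u = fibre_comp a b v \<longleftrightarrow> (u, v) \<in> monom_cong (edges_below a b)"
proof
  assume "fibre_comp a b u = fibre_comp a b v"
  moreover have "v \<in> fibre_comp a b v" using assms by (simp add: fibre_comp_def monom_cong_refl)
  ultimately have "v \<in> fibre_comp a b u" by simp
  then show "(u, v) \<in> monom_cong (edges_below a b)" by (simp add: fibre_comp_def)
next
  assume "(u, v) \<in> monom_cong (edges_below a b)"
  then show "fibre_comp a b u = fibre_comp a b v" unfolding fibre_comp_def using monom_cong_trans monom_cong_sym by blast
qed

lemma G_edges_iff:
  "{u, v} \<in> G_edges TYPE('k::field) a b \<longleftrightarrow>
    u \<in> G_verts a b \<and> v \<in> G_verts a b \<and> u \<noteq> v \<and> (u, v) \<in> monom_cong (edges_below a b)"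
  unfolding G_edges_def binomial_in_toric_ideal_below_iff
  by (auto simp: doubleton_eq_iff intro: monom_cong_sym)

text \<open>Adjacency in \<open>G(b)\<close> is a congruence restricted to distinct vertices, so
  components are cliques and walks shorten to single edges.\<close>

lemma G_comps_eq: "G_comps TYPE('k::field) a b = fibre_comp a b ` G_verts a b"
proof -
  let ?V = "G_verts a b" and ?R = "{(p, q). {p, q} \<in> G_edges TYPE('k) a b}"
  have "(u, v) \<in> ?R\<^sup>* \<longleftrightarrow> (u, v) \<in> monom_cong (edges_below a b)" if "u \<in> ?V" "v \<in> ?V" for u v
  proof
    assume "(u, v) \<in> ?R\<^sup>*"
    then show "(u, v) \<in> monom_cong (edges_below a b)"
    proof (induction rule: rtrancl_induct)
      case (step y z)
      then have "(y, z) \<in> monom_cong (edges_below a b)" using G_edges_iff by blast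
      with step.IH show ?case by (rule monom_cong_trans)
    qed (rule monom_cong_refl)
  next
    assume "(u, v) \<in> monom_cong (edges_below a b)"
    then have "u = v \<or> (u, v) \<in> ?R" using that by (simp add: G_edges_iff)
    then show "(u, v) \<in> ?R\<^sup>*" by blast
  qed
  then have "{(u, v). u \<in> ?V \<and> v \<in> ?V \<and> (u, v) \<in> ?R\<^sup>*} `` {x} = fibre_comp a b x" if "x \<in> ?V" for x
    using that by (auto simp: fibre_comp_def)
  then show ?thesis unfolding G_comps_def graph_components_def quotient_def by blast
qed

text \<open>Two monomials of degree \<open>b\<close> are linked by basis edges whose first ends
  divide the starting monomial. If \<open>b\<close> is not the degree of a basis pair, all these
  edges lie strictly below \<open>b\<close>, so \<open>G(b)\<close> is connected.\<close>

lemma finite_nontrivial_degrees: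
  "finite {b \<in> NA a. n_comps TYPE('k::field) a b \<noteq> 1}"
proof -
  obtain M where M: "finite M" "degree_basis a M" by (rule ex_degree_basis)
  have "n_comps TYPE('k) a b = 1" if b: "b \<in> NA a" "b \<notin> (\<lambda>(p, q). deg_A a p) ` M" for b
  proof -
    obtain u where u: "u \<in> G_verts a b" using b(1) by (auto simp: G_verts_def NA_eq_range)
    have "(v, u) \<in> monom_cong (edges_below a b)" if v: "v \<in> G_verts a b" for v
    proof -
      have "basis_edges M v \<subseteq> edges_below a b"
      proof
        fix e assume "e \<in> basis_edges M v"
        then obtain p q w where pq: "(p, q) \<in> M" "v = p + w" "e = {p, q}"
          unfolding basis_edges_def by blast
        have "deg_A a p \<noteq> b" using pq(1) b(2) by force
        moreover have "b = deg_A a p + deg_A a w" using v pq(2) by (simp add: G_verts_def deg_A_add)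
        ultimately have "less_NA a (deg_A a p) b" unfolding less_NA_iff by force
        moreover have "deg_A a p = deg_A a q" using M(2) pq(1) unfolding degree_basis_def by blast
        ultimately show "e \<in> edges_below a b" unfolding pq(3) edges_below_iff by blast
      qed
      moreover have "(v, u) \<in> monom_cong (basis_edges M v)"
        using u v by (intro monom_cong_basis[OF M(2)]) (simp add: G_verts_def)
      ultimately show ?thesis using monom_cong_mono by blast
    qed
    then have "fibre_comp a b ` G_verts a b = {fibre_comp a b u}" using u fibre_comp_eq_iff by blast
    then show ?thesis by (simp add: n_comps_def G_comps_eq ecard_def one_enat_def)
  qed
  then have "{b \<in> NA a. n_comps TYPE('k) a b \<noteq> 1} \<subseteq> (\<lambda>(p, q). deg_A a p) ` M" by blast
  then show ?thesis using M(1) finite_surj by blast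
qed

section \<open>Minimal systems of binomials as edge sets\<close>

definition proper_edges :: "('m::finite \<Rightarrow> int ^ 'n) \<Rightarrow> 'm monom set set" where
  "proper_edges a = {{u, v} | u v. deg_A a u = deg_A a v \<and> u \<noteq> v}"

definition min_generating :: "('m::finite \<Rightarrow> int ^ 'n) \<Rightarrow> 'm monom set set set" where
  "min_generating a = {E. E \<subseteq> proper_edges a \<and> monom_cong E = monom_cong (deg_edges a) \<and>
     (\<forall>E'. E' \<subset> E \<longrightarrow> monom_cong E' \<noteq> monom_cong (deg_edges a))}"

lemma proper_edges_iff: "{p, q} \<in> proper_edges a \<longleftrightarrow> deg_A a p = deg_A a q \<and> p \<noteq> q"
  unfolding proper_edges_def by (rule doubleton_in_iff) metis

lemma min_generatingD:
  assumes "E \<in> min_generating a"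
  shows "E \<subseteq> proper_edges a" "monom_cong E = monom_cong (deg_edges a)"
    "\<And>E'. E' \<subset> E \<Longrightarrow> monom_cong E' \<noteq> monom_cong (deg_edges a)"
  using assms unfolding min_generating_def by blast+

text \<open>Both ideals are generated by binomials, so they agree as soon as they contain the same
  binomials.\<close>

lemma ideal_gen_eq_toric_ideal_iff:
  fixes S :: "('m::finite, 'k::field) mpoly set"
  assumes "\<forall>f\<in>S. is_binomial f"
  shows "ideal_gen S = toric_ideal a \<longleftrightarrow> monom_cong (binomial_edges S) = monom_cong (deg_edges a)"
proof
  assume eq: "ideal_gen S = toric_ideal a"
  have "(u, v) \<in> monom_cong (binomial_edges S) \<longleftrightarrow> (u, v) \<in> monom_cong (deg_edges a)" for u v
    unfolding binomial_in_ideal_gen_iff[OF assms, symmetric] eq monom_cong_deg_edges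
    by (rule binomial_in_toric_ideal_iff)
  then show "monom_cong (binomial_edges S) = monom_cong (deg_edges a)" by (intro set_eqI) (simp add: split_paired_all)
next
  assume eq: "monom_cong (binomial_edges S) = monom_cong (deg_edges a)"
  have iff: "x_pow u - x_pow v \<in> ideal_gen S \<longleftrightarrow> deg_A a u = deg_A a v" for u v
    unfolding binomial_in_ideal_gen_iff[OF assms] eq by (rule monom_cong_deg_edges)
  show "ideal_gen S = toric_ideal a"
  proof
    have "f \<in> toric_ideal a" if fS: "f \<in> S" for f
    proof -
      obtain u v where f: "f = x_pow u - x_pow v" using fS assms unfolding is_binomial_def by blast
      show ?thesis
        using ideal_gen_base[OF fS] unfolding f iff binomial_in_toric_ideal_iff .
    qed
    then show "ideal_gen S \<subseteq> toric_ideal a"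
      unfolding toric_ideal_def by (subst ideal_gen_subset) blast
    show "toric_ideal a \<subseteq> ideal_gen S"
      unfolding toric_ideal_def ideal_gen_subset using iff by blast
  qed
qed

text \<open>The class \<open>{f, - f}\<close> belonging to an edge, which matches the encoding in
  \<open>up_to_sign\<close>.\<close>

definition edge_binomials :: "'m monom set \<Rightarrow> ('m, 'k::comm_ring_1) mpoly set" where
  "edge_binomials e = {x_pow u - x_pow v | u v. e = {u, v}}"

lemma edge_binomials_pair:
  "edge_binomials {u, v} = {x_pow u - x_pow v, - (x_pow u - x_pow v)}"
proof -
  have "edge_binomials {u, v} = {x_pow u - x_pow v, x_pow v - x_pow u}"
    unfolding edge_binomials_def doubleton_eq_iff by blast
  then show ?thesis by simp
qed

lemma inj_on_edge_binomials:
  "inj_on (edge_binomials :: _ \<Rightarrow> ('m::finite, 'k::comm_ring_1) mpoly set) (proper_edges a)"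
proof (rule inj_onI)
  fix e e' :: "'m monom set"
  assume e: "e \<in> proper_edges a" and "e' \<in> proper_edges a"
    and eq: "edge_binomials e = (edge_binomials e' :: ('m, 'k) mpoly set)"
  obtain u v where uv: "e = {u, v}" "u \<noteq> v" using e unfolding proper_edges_def by blast
  have "(x_pow u - x_pow v :: ('m, 'k) mpoly) \<in> edge_binomials e'"
    unfolding eq[symmetric] uv edge_binomials_pair by blast
  then obtain u' v' where "e' = {u', v'}" "(x_pow u - x_pow v :: ('m, 'k) mpoly) = x_pow u' - x_pow v'"
    unfolding edge_binomials_def by blast
  then show "e = e'" using x_pow_diff_eqD uv by metis
qed

section \<open>Minimal systems up to sign\<close>

lemma up_to_sign_eq:
  fixes S :: "('m, 'k::comm_ring_1) mpoly set"
  assumes "\<forall>f\<in>S. is_binomial f"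
  shows "up_to_sign S = edge_binomials ` binomial_edges S"
proof
  show "up_to_sign S \<subseteq> edge_binomials ` binomial_edges S"
    unfolding up_to_sign_def
  proof (rule image_subsetI)
    fix f assume f: "f \<in> S"
    then obtain u v where uv: "f = x_pow u - x_pow v" using assms unfolding is_binomial_def by blast
    then have "{u, v} \<in> binomial_edges S" using f unfolding binomial_edges_def by blast
    then show "{f, - f} \<in> edge_binomials ` binomial_edges S"
      unfolding uv edge_binomials_pair[symmetric] by (rule imageI)
  qed
  show "edge_binomials ` binomial_edges S \<subseteq> up_to_sign S"
  proof (rule image_subsetI)
    fix e assume "e \<in> binomial_edges S"
    then obtain u v where uv: "e = {u, v}" "x_pow u - x_pow v \<in> S"
      unfolding binomial_edges_def by blast
    show "edge_binomials e \<in> up_to_sign S"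
      unfolding up_to_sign_def uv(1) edge_binomials_pair using uv(2) by (rule imageI)
  qed
qed

lemma binomial_edges_mono: "S \<subseteq> T \<Longrightarrow> binomial_edges S \<subseteq> binomial_edges T"
  unfolding binomial_edges_def by blast

lemma monom_cong_remove_loop: "monom_cong (E - {{u}}) = monom_cong E"
proof
  show "monom_cong E \<subseteq> monom_cong (E - {{u}})"
  proof (rule monom_cong_subset)
    fix p q assume "{p, q} \<in> E"
    then show "(p, q) \<in> monom_cong (E - {{u}})"
      by (cases "{p, q} = {u}") (auto intro: monom_cong_edge monom_cong_refl)
  qed
qed (rule monom_cong_mono, blast)

text \<open>Minimality excludes 0, which would contribute nothing but loops. Every member then has
  exactly one edge, and a smaller generating edge set would pull back to a smaller system.\<close>

lemma binomial_edges_minimal_system: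
  fixes S :: "('m::finite, 'k::field) mpoly set"
  assumes "minimal_binomial_system (toric_ideal a) S"
  shows "binomial_edges S \<in> min_generating a"
proof -
  have S: "\<forall>f\<in>S. is_binomial f" "ideal_gen S = toric_ideal a"
    "\<And>T. T \<subset> S \<Longrightarrow> ideal_gen T \<noteq> toric_ideal a"
    using assms unfolding minimal_binomial_system_def by blast+
  have monom_cong: "monom_cong (binomial_edges S) = monom_cong (deg_edges a)"
    using S(2) unfolding ideal_gen_eq_toric_ideal_iff[OF S(1)] .
  have not_full: "monom_cong (binomial_edges T) \<noteq> monom_cong (deg_edges a)" if "T \<subset> S" for T
  proof -
    have "\<forall>f\<in>T. is_binomial f" using that S(1) by blast
    then show ?thesis using S(3)[OF that] ideal_gen_eq_toric_ideal_iff by blast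
  qed
  have no0: "0 \<notin> S"
  proof
    assume 0: "0 \<in> S"
    have "monom_cong (binomial_edges S) \<subseteq> monom_cong (binomial_edges (S - {0}))"
    proof (rule monom_cong_subset)
      fix p q assume "{p, q} \<in> binomial_edges S"
      then obtain u v where uv: "{p, q} = {u, v}" "x_pow u - x_pow v \<in> S"
        unfolding binomial_edges_def by blast
      show "(p, q) \<in> monom_cong (binomial_edges (S - {0}))"
      proof (cases "u = v")
        case True
        then have "p = q" using uv(1) by auto
        then show ?thesis by (simp add: monom_cong_refl)
      next
        case False
        then have "x_pow u - x_pow v \<in> S - {0}" using uv(2) by (simp add: x_pow_eq_iff)
        then have "{u, v} \<in> binomial_edges (S - {0})" unfolding binomial_edges_def by blast
        then show ?thesis unfolding uv(1)[symmetric] by (rule monom_cong_edge)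
      qed
    qed
    moreover have "monom_cong (binomial_edges (S - {0})) \<subseteq> monom_cong (binomial_edges S)"
      by (intro monom_cong_mono binomial_edges_mono) blast
    ultimately show False using not_full[of "S - {0}"] monom_cong 0 by blast
  qed
  have "binomial_edges S \<subseteq> proper_edges a"
  proof
    fix e assume "e \<in> binomial_edges S"
    then obtain u v where uv: "e = {u, v}" "x_pow u - x_pow v \<in> S"
      unfolding binomial_edges_def by blast
    have "u \<noteq> v" using uv(2) no0 by auto
    moreover have "x_pow u - x_pow v \<in> (toric_ideal a :: ('m, 'k) mpoly set)"
      using ideal_gen_base[OF uv(2)] unfolding S(2) .
    ultimately show "e \<in> proper_edges a"
      unfolding uv(1) proper_edges_iff binomial_in_toric_ideal_iff by blast
  qed
  moreover have "monom_cong E' \<noteq> monom_cong (deg_edges a)" if E': "E' \<subset> binomial_edges S" for E'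
  proof -
    \<comment> \<open>The pullback of \<open>E'\<close>: all members of \<open>S\<close> whose edge
      lies in \<open>E'\<close>.\<close>
    define T where "T = {f \<in> S. \<exists>u v. f = x_pow u - x_pow v \<and> {u, v} \<in> E'}"
    have "binomial_edges T = E'"
    proof
      show "binomial_edges T \<subseteq> E'"
      proof
        fix e assume "e \<in> binomial_edges T"
        then obtain u v u' v' where uv: "e = {u, v}" "x_pow u - x_pow v \<in> S"
          "(x_pow u - x_pow v :: ('m, 'k) mpoly) = x_pow u' - x_pow v'" "{u', v'} \<in> E'"
          unfolding binomial_edges_def T_def by blast
        have "u \<noteq> v" using uv(2) no0 by auto
        then show "e \<in> E'" using x_pow_diff_eqD[OF uv(3)] uv(1,4) by simp
      qed
      show "E' \<subseteq> binomial_edges T"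
      proof
        fix e assume e: "e \<in> E'"
        then have "e \<in> binomial_edges S" using E' by blast
        then obtain u v where "e = {u, v}" "x_pow u - x_pow v \<in> S"
          unfolding binomial_edges_def by blast
        then show "e \<in> binomial_edges T" using e unfolding binomial_edges_def T_def by blast
      qed
    qed
    moreover from this have "T \<noteq> S" using E' by blast
    then have "T \<subset> S" unfolding T_def by blast
    ultimately show ?thesis using not_full by blast
  qed
  ultimately show ?thesis unfolding min_generating_def using monom_cong by blast
qed

text \<open>One sign is chosen for each edge. A generating subset of the chosen binomials has all of
  \<open>E\<close> as edges by minimality of \<open>E\<close>, and one binomial per edge leaves
  nothing to omit.\<close>

lemma min_generating_orientation:
  fixes a :: "'m::finite \<Rightarrow> int ^ 'n"
  assumes E: "E \<in> min_generating a"
  obtains S :: "('m, 'k::field) mpoly set"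
  where "minimal_binomial_system (toric_ideal a) S" "binomial_edges S = E"
proof -
  define f :: "'m monom set \<Rightarrow> ('m, 'k) mpoly" where "f e = (SOME f. f \<in> edge_binomials e)" for e
  note E' = min_generatingD[OF E]
  have proper: "\<exists>u v. e = {u, v} \<and> u \<noteq> v" if "e \<in> E" for e
    using that E'(1) unfolding proper_edges_def by blast
  have f_ex: "\<exists>u v. e = {u, v} \<and> f e = x_pow u - x_pow v" if e: "e \<in> E" for e
  proof -
    have "edge_binomials e \<noteq> ({} :: ('m, 'k) mpoly set)"
      using proper[OF e] unfolding edge_binomials_def by blast
    then have "f e \<in> edge_binomials e" unfolding f_def by (intro some_in_eq[THEN iffD2])
    then show ?thesis unfolding edge_binomials_def by blast
  qed
  have f_inj: "e = {u, v}" if e: "e \<in> E" and fe: "f e = x_pow u - x_pow v" for e u v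
  proof -
    obtain u' v' where uv: "e = {u', v'}" "f e = x_pow u' - x_pow v'" using f_ex[OF e] by blast
    moreover have "u' \<noteq> v'" using proper[OF e] uv(1) by auto
    ultimately show ?thesis using x_pow_diff_eqD[of u' v' u v] fe by metis
  qed
  have bin: "\<forall>f\<in>f ` E. is_binomial f" using f_ex unfolding is_binomial_def by blast
  have be: "binomial_edges (f ` E) = E"
  proof
    show "binomial_edges (f ` E) \<subseteq> E"
    proof
      fix e assume "e \<in> binomial_edges (f ` E)"
      then obtain u v e' where "e = {u, v}" "f e' = x_pow u - x_pow v" "e' \<in> E"
        unfolding binomial_edges_def by auto
      then show "e \<in> E" using f_inj by simp
    qed
    show "E \<subseteq> binomial_edges (f ` E)"
    proof
      fix e assume e: "e \<in> E"
      then obtain u v where "e = {u, v}" "f e = x_pow u - x_pow v" using f_ex by blast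
      then show "e \<in> binomial_edges (f ` E)"
        using imageI[OF e, of f] unfolding binomial_edges_def by auto
    qed
  qed
  have "ideal_gen T \<noteq> toric_ideal a" if T: "T \<subset> f ` E" for T
  proof
    assume "ideal_gen T = toric_ideal a"
    moreover have "\<forall>f\<in>T. is_binomial f" using T bin by blast
    ultimately have "monom_cong (binomial_edges T) = monom_cong (deg_edges a)"
      using ideal_gen_eq_toric_ideal_iff by blast
    moreover have "binomial_edges T \<subseteq> E" using binomial_edges_mono[of T "f ` E"] T be by blast
    ultimately have TE: "binomial_edges T = E" using E'(3) by blast
    have "f e \<in> T" if e: "e \<in> E" for e
    proof -
      obtain u v where uv: "e = {u, v}" "x_pow u - x_pow v \<in> T"
        using e TE unfolding binomial_edges_def by blast
      moreover from this have "x_pow u - x_pow v \<in> f ` E" using T by blast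
      then obtain e' where "x_pow u - x_pow v = f e'" "e' \<in> E" by (rule imageE)
      moreover from this have "e' = {u, v}" by (intro f_inj) simp_all
      ultimately show ?thesis by simp
    qed
    then show False using T by blast
  qed
  moreover have "ideal_gen (f ` E) = toric_ideal a"
    unfolding ideal_gen_eq_toric_ideal_iff[OF bin] be by (rule E'(2))
  ultimately have "minimal_binomial_system (toric_ideal a) (f ` E)"
    unfolding minimal_binomial_system_def using bin by blast
  then show thesis using be by (rule that)
qed

lemma ecard_image: "inj_on f A \<Longrightarrow> ecard (f ` A) = ecard A"
  by (simp add: ecard_def finite_image_iff card_image)

text \<open>A system up to sign is the image of its edge set under \<open>edge_binomials\<close>,
  which is injective on proper edges; so edge sets can be counted instead.\<close>

lemma nu_toric_ideal:
  fixes a :: "'m::finite \<Rightarrow> int ^ 'n"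
  shows "\<nu> (toric_ideal a :: ('m, 'k::field) mpoly set) = ecard (min_generating a)"
proof -
  let ?\<beta> = "edge_binomials :: _ \<Rightarrow> ('m, 'k) mpoly set"
  have "up_to_sign ` {S :: ('m, 'k) mpoly set. minimal_binomial_system (toric_ideal a) S} =
      image ?\<beta> ` min_generating a"
  proof
    show "up_to_sign ` {S. minimal_binomial_system (toric_ideal a) S} \<subseteq> image ?\<beta> ` min_generating a"
    proof (rule image_subsetI)
      fix S :: "('m, 'k) mpoly set"
      assume "S \<in> {S. minimal_binomial_system (toric_ideal a) S}"
      then have S: "minimal_binomial_system (toric_ideal a) S" by simp
      then have "up_to_sign S = ?\<beta> ` binomial_edges S"
        by (intro up_to_sign_eq) (simp add: minimal_binomial_system_def)
      then show "up_to_sign S \<in> image ?\<beta> ` min_generating a"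
        using binomial_edges_minimal_system[OF S] by blast
    qed
    show "image ?\<beta> ` min_generating a \<subseteq> up_to_sign ` {S. minimal_binomial_system (toric_ideal a) S}"
    proof (rule image_subsetI)
      fix E assume "E \<in> min_generating a"
      then obtain S :: "('m, 'k) mpoly set"
        where S: "minimal_binomial_system (toric_ideal a) S" "binomial_edges S = E"
        by (rule min_generating_orientation)
      then have "?\<beta> ` E = up_to_sign S"
        by (subst up_to_sign_eq) (simp_all add: minimal_binomial_system_def)
      then show "?\<beta> ` E \<in> up_to_sign ` {S. minimal_binomial_system (toric_ideal a) S}"
        using S(1) by blast
    qed
  qed
  moreover have "inj_on ?\<beta> (\<Union> (min_generating a))"
    by (rule inj_on_subset[OF inj_on_edge_binomials[of a]]) (auto dest: min_generatingD(1))
  then have "inj_on (image ?\<beta>) (min_generating a)" by (rule inj_on_image)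
  ultimately show ?thesis unfolding \<nu>_def by (simp add: ecard_image)
qed

section \<open>Configurations without zero vectors\<close>

definition fibre_edges :: "('m::finite \<Rightarrow> int ^ 'n) \<Rightarrow> 'm monom set set \<Rightarrow> int ^ 'n \<Rightarrow> 'm monom set set" where
  "fibre_edges a E b = E \<inter> edges_on (G_verts a b)"

lemma proper_edges_fibre:
  assumes "e \<in> proper_edges a"
  obtains b where "b \<in> NA a" "e \<in> edges_on (G_verts a b)"
proof -
  obtain u v where uv: "e = {u, v}" "deg_A a u = deg_A a v" "u \<noteq> v"
    using assms unfolding proper_edges_def by blast
  then have "e \<in> edges_on (G_verts a (deg_A a u))" by (simp add: pair_in_edges_on G_verts_def)
  then show thesis using that deg_A_in_NA by blast
qed

lemma edges_on_G_verts_unique: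
  assumes "e \<in> edges_on (G_verts a b)" "e \<in> edges_on (G_verts a d)"
  shows "b = d"
proof -
  obtain u v where "e = {u, v}" using assms(1) by (rule edges_onE)
  then show ?thesis using assms by (simp add: pair_in_edges_on G_verts_def)
qed

lemma edges_on_subset_proper: "edges_on (G_verts a b) \<subseteq> proper_edges a"
proof
  fix e assume e: "e \<in> edges_on (G_verts a b)"
  then obtain u v where "e = {u, v}" by (rule edges_onE)
  then show "e \<in> proper_edges a" using e by (simp add: pair_in_edges_on G_verts_def proper_edges_iff)
qed

text \<open>Follow a chain of translated edges inside the fibre. A step with \<open>w = 0\<close> is
  an edge of degree \<open>b\<close>; with \<open>w \<noteq> 0\<close> the edge has degree strictly
  below \<open>b\<close>, so the step stays in one component of \<open>G(b)\<close>.\<close>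

lemma connects_fibre_if_generating:
  assumes a: "pointed (NA a)" "\<And>i. a i \<noteq> 0"
    and E: "E \<subseteq> proper_edges a" "monom_cong E = monom_cong (deg_edges a)"
  shows "connects (G_verts a b) (fibre_comp a b) (fibre_edges a E b)"
proof (rule connectsI)
  fix X u v
  assume cl: "\<And>x y. x \<in> G_verts a b \<Longrightarrow> y \<in> G_verts a b \<Longrightarrow> fibre_comp a b x = fibre_comp a b y \<Longrightarrow>
      x \<in> X \<Longrightarrow> y \<in> X"
    and ed: "\<And>x y. {x, y} \<in> fibre_edges a E b \<Longrightarrow> x \<in> X \<Longrightarrow> y \<in> X"
    and uv: "u \<in> G_verts a b" "v \<in> G_verts a b" "u \<in> X"
  have "(u, v) \<in> monom_cong E" unfolding E(2) monom_cong_deg_edges using uv by (simp add: G_verts_def)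
  then have "v \<in> G_verts a b \<and> v \<in> X"
  proof (induction rule: monom_cong_induct)
    case refl
    show ?case using uv by blast
  next
    case (step p q w)
    have "{p, q} \<in> proper_edges a" using step.hyps(2) E(1) by blast
    then have pq: "deg_A a p = deg_A a q" "p \<noteq> q" unfolding proper_edges_iff by simp_all
    have pw: "p + w \<in> G_verts a b" "p + w \<in> X" using step.IH by simp_all
    have qw: "q + w \<in> G_verts a b" using pw(1) pq(1) by (simp add: G_verts_def deg_A_add)
    have "q + w \<in> X"
    proof (cases "w = 0")
      case True
      then have "{p, q} \<in> fibre_edges a E b"
        using pw(1) qw pq(2) step.hyps(2) by (simp add: fibre_edges_def pair_in_edges_on)
      then show ?thesis using ed[of p q] pw(2) True by simp
    next
      case False
      then have "deg_A a w \<noteq> 0" using deg_A_eq_0D[OF a] by blast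
      moreover have "b = deg_A a p + deg_A a w" using pw(1) by (simp add: G_verts_def deg_A_add)
      ultimately have "{p, q} \<in> edges_below a b"
        unfolding edges_below_iff less_NA_iff using pq(1) by blast
      then have "fibre_comp a b (p + w) = fibre_comp a b (q + w)"
        unfolding fibre_comp_eq_iff[OF pw(1) qw] by (rule monom_cong_translate)
      then show ?thesis by (rule cl[OF pw(1) qw _ pw(2)])
    qed
    then show ?case using qw by blast
  qed
  then show "v \<in> X" by blast
qed

text \<open>Induction on \<open>height\<close>: once all lower fibres are linked, \<open>E\<close>
  generates the congruence of \<open>edges_below a b\<close>, and the edges of degree
  \<open>b\<close> join the components that remain.\<close>

lemma generating_if_connects_fibres:
  assumes a: "pointed (NA a)" "\<And>i. a i \<noteq> 0"
    and E: "E \<subseteq> proper_edges a"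
    and con: "\<And>b. b \<in> NA a \<Longrightarrow> connects (G_verts a b) (fibre_comp a b) (fibre_edges a E b)"
  shows "monom_cong E = monom_cong (deg_edges a)"
proof
  show "monom_cong E \<subseteq> monom_cong (deg_edges a)"
  proof (rule monom_cong_mono, rule order.trans[OF E])
    show "proper_edges a \<subseteq> deg_edges a" unfolding proper_edges_def deg_edges_def by blast
  qed
  have full: "(u, v) \<in> monom_cong E" if "u \<in> G_verts a b" "v \<in> G_verts a b" for b u v
    using that
  proof (induction "height a b" arbitrary: b u v rule: less_induct)
    case less
    have b: "b \<in> NA a" using less.prems(1) deg_A_in_NA by (force simp: G_verts_def)
    have below: "monom_cong (edges_below a b) \<subseteq> monom_cong E"
    proof (rule monom_cong_subset)
      fix p q assume "{p, q} \<in> edges_below a b"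
      then have pq: "deg_A a p = deg_A a q" "less_NA a (deg_A a p) b"
        unfolding edges_below_iff by blast+
      show "(p, q) \<in> monom_cong E"
        using height_less[OF a deg_A_in_NA pq(2)] by (rule less.hyps) (simp_all add: G_verts_def pq(1))
    qed
    have "v \<in> {v. (u, v) \<in> monom_cong E}"
    proof (rule connectsD[OF con[OF b] _ _ less.prems])
      fix x y assume xy: "x \<in> G_verts a b" "y \<in> G_verts a b" "fibre_comp a b x = fibre_comp a b y"
        and x: "x \<in> {v. (u, v) \<in> monom_cong E}"
      have "(x, y) \<in> monom_cong E" using xy(3) below unfolding fibre_comp_eq_iff[OF xy(1,2)] by blast
      then show "y \<in> {v. (u, v) \<in> monom_cong E}" using x monom_cong_trans by blast
    next
      fix x y assume xy: "{x, y} \<in> fibre_edges a E b" and x: "x \<in> {v. (u, v) \<in> monom_cong E}"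
      have "{x, y} \<in> E" using xy unfolding fibre_edges_def by blast
      then show "y \<in> {v. (u, v) \<in> monom_cong E}" using x monom_cong_trans monom_cong_edge by blast
    qed (simp add: monom_cong_refl)
    then show ?case by simp
  qed
  show "monom_cong (deg_edges a) \<subseteq> monom_cong E"
  proof (rule subrelI)
    fix u v assume "(u, v) \<in> monom_cong (deg_edges a)"
    then have "deg_A a u = deg_A a v" by (simp add: monom_cong_deg_edges)
    then show "(u, v) \<in> monom_cong E" by (intro full[where b = "deg_A a v"]) (simp_all add: G_verts_def)
  qed
qed

lemma generating_iff:
  assumes "pointed (NA a)" "\<And>i. a i \<noteq> 0" "E \<subseteq> proper_edges a"
  shows "monom_cong E = monom_cong (deg_edges a) \<longleftrightarrow>
    (\<forall>b\<in>NA a. connects (G_verts a b) (fibre_comp a b) (fibre_edges a E b))"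
  using connects_fibre_if_generating[OF assms] generating_if_connects_fibres[OF assms] by blast

text \<open>An edge has only one degree and generation is a condition on each degree, so removing
  edges in one degree leaves the other conditions intact and minimality can be tested degree by
  degree.\<close>

lemma min_generating_iff:
  assumes a: "pointed (NA a)" "\<And>i. a i \<noteq> 0" and E: "E \<subseteq> proper_edges a"
  shows "E \<in> min_generating a \<longleftrightarrow> (\<forall>b\<in>NA a. fibre_edges a E b \<in> trees (G_verts a b) (fibre_comp a b))"
proof
  assume "E \<in> min_generating a"
  note M = min_generatingD[OF this]
  show "\<forall>b\<in>NA a. fibre_edges a E b \<in> trees (G_verts a b) (fibre_comp a b)"
  proof
    fix b assume b: "b \<in> NA a"
    have "\<not> connects (G_verts a b) (fibre_comp a b) P" if P: "P \<subset> fibre_edges a E b" for P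
    proof
      assume con: "connects (G_verts a b) (fibre_comp a b) P"
      \<comment> \<open>Only the edges of degree \<open>b\<close> are thinned out, to
        \<open>P\<close>.\<close>
      define E' where "E' = (E - edges_on (G_verts a b)) \<union> P"
      have "E' \<subset> E" using P unfolding E'_def fibre_edges_def by blast
      then have "monom_cong E' \<noteq> monom_cong (deg_edges a)" by (rule M(3))
      moreover have "E' \<subseteq> proper_edges a" using \<open>E' \<subset> E\<close> E by blast
      moreover have "connects (G_verts a d) (fibre_comp a d) (fibre_edges a E' d)" if d: "d \<in> NA a" for d
      proof (cases "d = b")
        case True
        have "fibre_edges a E' b = P" using P unfolding E'_def fibre_edges_def by blast
        then show ?thesis using con True by simp
      next
        case False
        then have "edges_on (G_verts a b) \<inter> edges_on (G_verts a d) = {}"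
          using edges_on_G_verts_unique by blast
        then have "fibre_edges a E' d = fibre_edges a E d"
          using P unfolding E'_def fibre_edges_def by blast
        then show ?thesis using generating_iff[OF a E] M(2) d by simp
      qed
      ultimately show False using generating_iff[OF a] by blast
    qed
    moreover have "connects (G_verts a b) (fibre_comp a b) (fibre_edges a E b)"
      using generating_iff[OF a E] M(2) b by blast
    moreover have "fibre_edges a E b \<subseteq> edges_on (G_verts a b)"
      unfolding fibre_edges_def by blast
    ultimately show "fibre_edges a E b \<in> trees (G_verts a b) (fibre_comp a b)"
      unfolding trees_def by blast
  qed
next
  assume trees: "\<forall>b\<in>NA a. fibre_edges a E b \<in> trees (G_verts a b) (fibre_comp a b)"
  have "monom_cong E = monom_cong (deg_edges a)"
    unfolding generating_iff[OF a E] using trees tree_connects by blast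
  moreover have "monom_cong E' \<noteq> monom_cong (deg_edges a)" if E': "E' \<subset> E" for E'
  proof
    assume gen: "monom_cong E' = monom_cong (deg_edges a)"
    have E'p: "E' \<subseteq> proper_edges a" using E' E by blast
    obtain e where e: "e \<in> E" "e \<notin> E'" using E' by blast
    then have "e \<in> proper_edges a" using E by blast
    then obtain b where b: "b \<in> NA a" "e \<in> edges_on (G_verts a b)" by (rule proper_edges_fibre)
    have "fibre_edges a E' b \<subset> fibre_edges a E b" using e b(2) E' unfolding fibre_edges_def by blast
    then have "\<not> connects (G_verts a b) (fibre_comp a b) (fibre_edges a E' b)"
      using trees b(1) unfolding trees_def by blast
    then show False using gen generating_iff[OF a E'p] b(1) by blast
  qed
  ultimately show "E \<in> min_generating a" unfolding min_generating_def using E by blast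
qed

text \<open>The inverse takes the union of the chosen trees. Degrees outside \<open>B\<close> admit
  only the empty tree and add no edges.\<close>

lemma bij_betw_min_generating_PiE:
  assumes a: "pointed (NA a)" "\<And>i. a i \<noteq> 0" and B: "B \<subseteq> NA a"
    and triv: "\<And>b. b \<in> NA a - B \<Longrightarrow> trees (G_verts a b) (fibre_comp a b) = {{}}"
  shows "bij_betw (\<lambda>E. \<lambda>b\<in>B. fibre_edges a E b) (min_generating a)
    (\<Pi>\<^sub>E b\<in>B. trees (G_verts a b) (fibre_comp a b))"
proof (rule bij_betw_byWitness[where f' = "\<lambda>F. \<Union>b\<in>B. F b"])
  show "\<forall>E\<in>min_generating a. (\<Union>b\<in>B. (\<lambda>b\<in>B. fibre_edges a E b) b) = E"
  proof
    fix E assume E: "E \<in> min_generating a"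
    note Ep = min_generatingD(1)[OF E]
    have "E \<subseteq> (\<Union>b\<in>B. fibre_edges a E b)"
    proof
      fix e assume e: "e \<in> E"
      then have "e \<in> proper_edges a" using Ep by blast
      then obtain b where b: "b \<in> NA a" "e \<in> edges_on (G_verts a b)" by (rule proper_edges_fibre)
      have eb: "e \<in> fibre_edges a E b" using e b unfolding fibre_edges_def by blast
      have "fibre_edges a E b \<in> trees (G_verts a b) (fibre_comp a b)"
        using E b(1) unfolding min_generating_iff[OF a Ep] by blast
      then have "b \<in> B" using triv[of b] eb b(1) by blast
      then show "e \<in> (\<Union>b\<in>B. fibre_edges a E b)" using eb by blast
    qed
    then show "(\<Union>b\<in>B. (\<lambda>b\<in>B. fibre_edges a E b) b) = E" unfolding fibre_edges_def by auto
  qed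
  have fib: "fibre_edges a (\<Union>b\<in>B. F b) d = (if d \<in> B then F d else {})"
    if F: "F \<in> (\<Pi>\<^sub>E b\<in>B. trees (G_verts a b) (fibre_comp a b))" for F d
  proof -
    have sub: "F b \<subseteq> edges_on (G_verts a b)" if "b \<in> B" for b
      using PiE_mem[OF F that] by (rule tree_subset)
    show ?thesis
    proof (intro set_eqI iffI)
      fix e assume "e \<in> fibre_edges a (\<Union>b\<in>B. F b) d"
      then obtain b where b: "b \<in> B" "e \<in> F b" "e \<in> edges_on (G_verts a d)"
        unfolding fibre_edges_def by blast
      have "e \<in> edges_on (G_verts a b)" using sub[OF b(1)] b(2) by blast
      then have "b = d" using b(3) by (rule edges_on_G_verts_unique)
      then show "e \<in> (if d \<in> B then F d else {})" using b by simp
    next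
      fix e assume "e \<in> (if d \<in> B then F d else {})"
      then have "d \<in> B" "e \<in> F d" by (simp_all split: if_splits)
      then show "e \<in> fibre_edges a (\<Union>b\<in>B. F b) d"
        using sub unfolding fibre_edges_def by blast
    qed
  qed
  show "\<forall>F\<in>\<Pi>\<^sub>E b\<in>B. trees (G_verts a b) (fibre_comp a b).
      (\<lambda>b\<in>B. fibre_edges a (\<Union>b\<in>B. F b) b) = F"
  proof
    fix F assume F: "F \<in> (\<Pi>\<^sub>E b\<in>B. trees (G_verts a b) (fibre_comp a b))"
    show "(\<lambda>b\<in>B. fibre_edges a (\<Union>b\<in>B. F b) b) = F"
    proof (rule ext)
      fix d
      show "(\<lambda>b\<in>B. fibre_edges a (\<Union>b\<in>B. F b) b) d = F d"
        unfolding restrict_def fib[OF F] using PiE_arb[OF F, of d] by presburger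
    qed
  qed
  show "(\<lambda>E. \<lambda>b\<in>B. fibre_edges a E b) ` min_generating a \<subseteq>
      (\<Pi>\<^sub>E b\<in>B. trees (G_verts a b) (fibre_comp a b))"
  proof (rule image_subsetI)
    fix E assume E: "E \<in> min_generating a"
    show "(\<lambda>b\<in>B. fibre_edges a E b) \<in> (\<Pi>\<^sub>E b\<in>B. trees (G_verts a b) (fibre_comp a b))"
      using E B unfolding min_generating_iff[OF a min_generatingD(1)[OF E]]
      by (intro restrict_PiE_iff[THEN iffD2]) blast
  qed
  show "(\<lambda>F. \<Union>b\<in>B. F b) ` (\<Pi>\<^sub>E b\<in>B. trees (G_verts a b) (fibre_comp a b)) \<subseteq> min_generating a"
  proof (rule image_subsetI)
    fix F assume F: "F \<in> (\<Pi>\<^sub>E b\<in>B. trees (G_verts a b) (fibre_comp a b))"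
    have "F b \<subseteq> proper_edges a" if "b \<in> B" for b
      using tree_subset[OF PiE_mem[OF F that]] edges_on_subset_proper by blast
    then have sub: "(\<Union>b\<in>B. F b) \<subseteq> proper_edges a" by blast
    have "fibre_edges a (\<Union>b\<in>B. F b) d \<in> trees (G_verts a d) (fibre_comp a d)" if d: "d \<in> NA a" for d
      using PiE_mem[OF F] triv[of d] d by (simp add: fib[OF F])
    then show "(\<Union>b\<in>B. F b) \<in> min_generating a" unfolding min_generating_iff[OF a sub] by blast
  qed
qed

section \<open>The factor of a degree as a number of trees\<close>

lemma block_card_fibre_comp:
  assumes "C \<in> fibre_comp a b ` G_verts a b"
  shows "block_card (G_verts a b) (fibre_comp a b) C = card C"
proof -
  obtain u where u: "u \<in> G_verts a b" "C = fibre_comp a b u" using assms by blast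
  \<comment> \<open>The label of a block is the block itself.\<close>
  have "{x \<in> G_verts a b. fibre_comp a b x = C} = C"
  proof (rule set_eqI)
    fix x
    show "x \<in> {x \<in> G_verts a b. fibre_comp a b x = C} \<longleftrightarrow> x \<in> C"
    proof (cases "x \<in> G_verts a b")
      case True
      then have "fibre_comp a b x = C \<longleftrightarrow> (u, x) \<in> monom_cong (edges_below a b)"
        unfolding u(2) using fibre_comp_eq_iff[OF u(1) True] by blast
      then show ?thesis using True unfolding u(2) fibre_comp_def by blast
    next
      case False
      then show ?thesis unfolding u(2) fibre_comp_def by blast
    qed
  qed
  then show ?thesis by (simp add: block_card_def)
qed

text \<open>This is \<open>weighted_cayley\<close> with one factor \<open>card (G_verts a b)\<close>
  cancelled. A single component is treated apart, where the empty tree is the only one.\<close>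

lemma G_factor_eq_card_trees:
  assumes fin: "finite (G_verts a b)" and b: "b \<in> NA a"
  shows "G_factor TYPE('k::field) a b = enat (card (trees (G_verts a b) (fibre_comp a b)))"
proof -
  let ?V = "G_verts a b" and ?C = "fibre_comp a b ` G_verts a b" and ?T = "trees (G_verts a b) (fibre_comp a b)"
  have ne: "?V \<noteq> {}" using b by (auto simp: G_verts_def NA_eq_range)
  have finC: "finite ?C" using fin by simp
  show ?thesis
  proof (cases "card ?C = 1")
    case True
    then show ?thesis using trees_single_block[OF True] finC
      by (simp add: G_factor_def G_comps_eq one_enat_def Let_def)
  next
    case False
    moreover have "card ?C \<noteq> 0" using fin ne by simp
    \<comment> \<open>With at least two components the exponent leaves a power of
      \<open>card ?V\<close> to cancel.\<close>
    ultimately have n: "card ?C - 1 = Suc (card ?C - 2)" by linarith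
    have cards: "ecard C = of_nat (card C)" if "C \<in> ?C" for C
    proof -
      have "C \<subseteq> ?V" using that by (auto simp: fibre_comp_def)
      then show ?thesis using fin by (simp add: ecard_def finite_subset of_nat_eq_enat)
    qed
    have sum: "(\<Sum>C\<in>?C. card C) = card ?V"
    proof -
      have "(\<Sum>C\<in>?C. card C) = (\<Sum>C\<in>?C. \<Sum>x\<in>{x \<in> ?V. fibre_comp a b x = C}. 1)"
        by (intro sum.cong refl) (simp add: block_card_fibre_comp[symmetric] block_card_def)
      also have "\<dots> = (\<Sum>x\<in>?V. 1)" using fin finC by (intro sum.group) auto
      finally show ?thesis by simp
    qed
    have "card ?V * card ?T = card ?V * (card ?V ^ (card ?C - 2) * (\<Prod>C\<in>?C. card C))"
      using weighted_cayley[OF fin ne, of "fibre_comp a b"] unfolding n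
      by (simp add: block_card_fibre_comp mult.assoc cong: prod.cong)
    then have T: "card ?T = card ?V ^ (card ?C - 2) * (\<Prod>C\<in>?C. card C)" using fin ne by simp
    have "G_factor TYPE('k) a b = (\<Prod>C\<in>?C. ecard C) * (\<Sum>C\<in>?C. ecard C) ^ (card ?C - 2)"
      using False finC by (simp add: G_factor_def G_comps_eq Let_def)
    also have "\<dots> = of_nat (card ?T)"
      unfolding T sum[symmetric] by (simp add: cards mult.commute cong: prod.cong sum.cong)
    finally show ?thesis by (simp add: of_nat_eq_enat)
  qed
qed

lemma nu_toric_ideal_nonzero:
  fixes a :: "'m::finite \<Rightarrow> int ^ 'n"
  assumes a: "pointed (NA a)" "\<And>i. a i \<noteq> 0"
  shows "\<nu> (toric_ideal a :: ('m, 'k::field) mpoly set) =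
      (\<Prod>b \<in> {b \<in> NA a. n_comps TYPE('k) a b \<noteq> 1}. G_factor TYPE('k) a b)"
proof -
  let ?T = "\<lambda>b. trees (G_verts a b) (fibre_comp a b)"
  define B where "B = {b \<in> NA a. n_comps TYPE('k) a b \<noteq> 1}"
  have finB: "finite B" unfolding B_def by (rule finite_nontrivial_degrees)
  note fin = finite_G_verts[OF a]
  have "?T b = {{}}" if "b \<in> NA a - B" for b
  proof -
    have "n_comps TYPE('k) a b = 1" using that unfolding B_def by blast
    then have "card (fibre_comp a b ` G_verts a b) = 1"
      using fin[of b] by (simp add: n_comps_def G_comps_eq ecard_def one_enat_def)
    then show ?thesis by (rule trees_single_block)
  qed
  then have bij: "bij_betw (\<lambda>E. \<lambda>b\<in>B. fibre_edges a E b) (min_generating a) (\<Pi>\<^sub>E b\<in>B. ?T b)"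
    by (intro bij_betw_min_generating_PiE[OF a]) (auto simp: B_def)
  have "finite (\<Pi>\<^sub>E b\<in>B. ?T b)" using finB fin finite_trees by (intro finite_PiE) auto
  then have "ecard (min_generating a) = enat (card (\<Pi>\<^sub>E b\<in>B. ?T b))"
    using bij by (simp add: ecard_def bij_betw_finite[OF bij] bij_betw_same_card[OF bij])
  also have "\<dots> = enat (\<Prod>b\<in>B. card (?T b))" using finB by (simp add: card_PiE)
  also have "\<dots> = (\<Prod>b\<in>B. enat (card (?T b)))" by (simp flip: of_nat_eq_enat)
  also have "\<dots> = (\<Prod>b\<in>B. G_factor TYPE('k) a b)"
    using fin by (intro prod.cong refl G_factor_eq_card_trees[symmetric]) (auto simp: B_def)
  finally show ?thesis unfolding nu_toric_ideal B_def .
qed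

section \<open>Configurations with a zero vector\<close>

text \<open>A generating subset of least cardinality is minimal, and it has no loops because
  dropping a loop keeps the congruence.\<close>

lemma ex_min_generating_subset:
  assumes fin: "finite E" and E: "E \<subseteq> deg_edges a" "monom_cong E = monom_cong (deg_edges a)"
  shows "\<exists>E'\<subseteq>E. E' \<in> min_generating a"
proof -
  have "E \<subseteq> E \<and> monom_cong E = monom_cong (deg_edges a)" using E(2) by blast
  from ex_has_least_nat[of "\<lambda>F. F \<subseteq> E \<and> monom_cong F = monom_cong (deg_edges a)", OF this, of card]
  obtain E' where E': "E' \<subseteq> E" "monom_cong E' = monom_cong (deg_edges a)"
    and least: "\<And>F. F \<subseteq> E \<Longrightarrow> monom_cong F = monom_cong (deg_edges a) \<Longrightarrow> card E' \<le> card F"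
    by (elim exE conjE) simp
  have finE': "finite E'" using E'(1) fin by (rule finite_subset)
  have min: "monom_cong F \<noteq> monom_cong (deg_edges a)" if F: "F \<subset> E'" for F
  proof
    assume "monom_cong F = monom_cong (deg_edges a)"
    then have "card E' \<le> card F" using F E'(1) by (intro least) blast+
    then show False using psubset_card_mono[OF finE' F] by simp
  qed
  have "E' \<subseteq> proper_edges a"
  proof
    fix e assume e: "e \<in> E'"
    then have "e \<in> deg_edges a" using E'(1) E(1) by blast
    then obtain u v where uv: "e = {u, v}" "deg_A a u = deg_A a v" unfolding deg_edges_def by blast
    have "u \<noteq> v"
    proof
      assume "u = v"
      then have "E' - {{u}} \<subset> E'" using e uv(1) by blast
      from min[OF this] show False using E'(2) by (simp add: monom_cong_remove_loop)
    qed
    then show "e \<in> proper_edges a" using uv by (simp add: proper_edges_iff)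
  qed
  then show ?thesis unfolding min_generating_def using E' min by blast
qed

text \<open>The substitution x_i = 1 on monomials.\<close>

definition drop_var :: "'m \<Rightarrow> 'm monom \<Rightarrow> 'm monom" where
  "drop_var i u = u - Poly_Mapping.single i (Poly_Mapping.lookup u i)"

lemma drop_var_add: "drop_var i u + Poly_Mapping.single i (Poly_Mapping.lookup u i) = u"
  unfolding drop_var_def
  by (intro poly_mapping_eqI) (simp add: lookup_add lookup_minus lookup_single when_def)

lemma lookup_drop_var: "Poly_Mapping.lookup (drop_var i u) i = 0"
  by (simp add: drop_var_def lookup_minus)

lemma deg_A_drop_var:
  assumes "a i = 0"
  shows "deg_A a (drop_var i u) = deg_A a u"
  using deg_A_add[of a "drop_var i u" "Poly_Mapping.single i (Poly_Mapping.lookup u i)"] assms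
  by (simp add: drop_var_add deg_A_single)

text \<open>The basis with x_i set to 1, together with x_i^m - 1 and x_i^n - 1: only the two added
  edges involve x_i.\<close>

definition power_edges :: "('m monom \<times> 'm monom) set \<Rightarrow> 'm \<Rightarrow> nat \<Rightarrow> nat \<Rightarrow> 'm monom set set" where
  "power_edges M i m n = (\<lambda>(p, q). {drop_var i p, drop_var i q}) ` M \<union>
     {{Poly_Mapping.single i m, 0}, {Poly_Mapping.single i n, 0}}"

text \<open>Multiplying x_i^m ~ 1 by x_i and comparing with x_i^(m+1) ~ 1 gives x_i ~ 1. Hence every
  monomial is congruent to its image under \<open>drop_var\<close>, which brings back all basis
  pairs.\<close>

lemma monom_cong_power_edges:
  fixes a :: "'m::finite \<Rightarrow> int ^ 'n"
  assumes M: "degree_basis a M" and i: "a i = 0"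
  shows "monom_cong (power_edges M i m (Suc m)) = monom_cong (deg_edges a)"
    and "power_edges M i m n \<subseteq> deg_edges a"
proof -
  let ?E = "power_edges M i m (Suc m)" and ?z = "\<lambda>k. Poly_Mapping.single i k :: 'm monom"
  show sub: "power_edges M i m n \<subseteq> deg_edges a" for n
  proof
    fix e assume "e \<in> power_edges M i m n"
    then consider p q where "(p, q) \<in> M" "e = {drop_var i p, drop_var i q}"
      | k where "e = {?z k, 0}" unfolding power_edges_def by auto
    then show "e \<in> deg_edges a"
    proof cases
      case 1
      then have "deg_A a p = deg_A a q" using M unfolding degree_basis_def by blast
      then show ?thesis unfolding 1(2) deg_edges_iff deg_A_drop_var[where a = a, OF i] .
    next
      case 2
      show ?thesis unfolding 2 deg_edges_iff using i by (simp add: deg_A_single deg_A_0)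
    qed
  qed
  have z0: "(?z k, 0) \<in> monom_cong ?E" if "k = m \<or> k = Suc m" for k
    using that by (intro monom_cong_edge) (auto simp: power_edges_def)
  have "(?z m + ?z 1, 0 + ?z 1) \<in> monom_cong ?E" by (intro monom_cong_add z0) simp
  moreover have "?z m + ?z 1 = ?z (Suc m)" by (simp add: single_add[symmetric])
  ultimately have "(?z (Suc m), ?z 1) \<in> monom_cong ?E" by simp
  then have z1: "(?z 1, 0) \<in> monom_cong ?E" using z0[of "Suc m"] monom_cong_sym monom_cong_trans by blast
  have zk: "(?z k, 0) \<in> monom_cong ?E" for k
  proof (induction k)
    case 0
    show ?case by (simp add: monom_cong_refl)
  next
    case (Suc k)
    have "(?z k + ?z 1, 0 + ?z 1) \<in> monom_cong ?E" using Suc by (rule monom_cong_add)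
    then have "(?z (Suc k), ?z 1) \<in> monom_cong ?E" by (simp add: single_add[symmetric])
    then show ?case using z1 by (rule monom_cong_trans)
  qed
  have drop: "(u, drop_var i u) \<in> monom_cong ?E" for u
    using monom_cong_add[OF zk[of "Poly_Mapping.lookup u i"], of "drop_var i u"]
    by (simp add: add.commute drop_var_add)
  have basis: "(p, q) \<in> monom_cong ?E" if pq: "(p, q) \<in> M" for p q
  proof -
    have "{drop_var i p, drop_var i q} \<in> ?E" using pq unfolding power_edges_def by force
    then have "(drop_var i p, drop_var i q) \<in> monom_cong ?E" by (rule monom_cong_edge)
    then show ?thesis using drop monom_cong_trans monom_cong_sym by metis
  qed
  show "monom_cong ?E = monom_cong (deg_edges a)"
  proof
    show "monom_cong ?E \<subseteq> monom_cong (deg_edges a)" by (rule monom_cong_mono[OF sub])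
    show "monom_cong (deg_edges a) \<subseteq> monom_cong ?E"
    proof (rule subrelI)
      fix u v assume "(u, v) \<in> monom_cong (deg_edges a)"
      then have "deg_A a u = deg_A a v" by (simp add: monom_cong_deg_edges)
      then have "(u, v) \<in> monom_cong (basis_edges M u)" by (rule monom_cong_basis[OF M])
      moreover have "monom_cong (basis_edges M u) \<subseteq> monom_cong ?E"
      proof (rule monom_cong_subset)
        fix p q assume "{p, q} \<in> basis_edges M u"
        then obtain p' q' where "(p', q') \<in> M" "{p, q} = {p', q'}" unfolding basis_edges_def by blast
        then show "(p, q) \<in> monom_cong ?E" unfolding doubleton_eq_iff using basis monom_cong_sym by blast
      qed
      ultimately show "(u, v) \<in> monom_cong ?E" by blast
    qed
  qed
qed

text \<open>The exponent of x_i modulo \<open>n\<close> is the invariant: without the edge of x_i^m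
  all edges preserve it, yet x_i ~ 1 would change it from 1 to 0.\<close>

lemma power_edge_needed:
  fixes a :: "'m::finite \<Rightarrow> int ^ 'n"
  assumes i: "a i = 0" and E: "E \<subseteq> power_edges M i m n" "monom_cong E = monom_cong (deg_edges a)" and n: "2 \<le> n"
  shows "{Poly_Mapping.single i m, 0} \<in> E"
proof (rule ccontr)
  let ?z = "\<lambda>k. Poly_Mapping.single i k :: 'm monom" and ?l = "\<lambda>u :: 'm monom. Poly_Mapping.lookup u i"
  assume m: "{?z m, 0} \<notin> E"
  have edge: "?l p mod n = ?l q mod n" if pq: "{p, q} \<in> E" for p q
  proof -
    have "{p, q} \<in> power_edges M i m n" using pq E(1) by blast
    then consider p' q' where "{p, q} = {drop_var i p', drop_var i q'}" | "{p, q} = {?z n, 0}"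
      using pq m unfolding power_edges_def by auto
    then show ?thesis
    proof cases
      case 1
      then have "?l p = 0" "?l q = 0" unfolding doubleton_eq_iff by (auto simp: lookup_drop_var)
      then show ?thesis by simp
    next
      case 2
      then show ?thesis unfolding doubleton_eq_iff by auto
    qed
  qed
  have "(?z 1, 0) \<in> monom_cong E"
    unfolding E(2) monom_cong_deg_edges using i by (simp add: deg_A_single deg_A_0)
  then have "?l (?z 1) mod n = ?l 0 mod n"
  proof (induction rule: monom_cong_induct)
    case (step p q w)
    have "(?l p + ?l w) mod n = (?l q + ?l w) mod n" using edge[OF step.hyps(2)] by (intro mod_add_cong) simp_all
    then show ?case using step.IH by (simp add: lookup_add)
  qed simp
  then show False using n by simp
qed

lemma power_edges_commute: "power_edges M i m n = power_edges M i n m"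
  unfolding power_edges_def by blast

lemma single_edge_in_power_edges:
  fixes i :: 'm
  assumes "{Poly_Mapping.single i j, 0} \<in> power_edges M i m n" "0 < j"
  shows "j = m \<or> j = n"
proof -
  let ?z = "\<lambda>k. Poly_Mapping.single i k :: 'm monom"
  consider p q where "{?z j, 0} = {drop_var i p, drop_var i q}" | k where "{?z j, 0} = {?z k, 0}" "k = m \<or> k = n"
    using assms(1) unfolding power_edges_def by auto
  then show ?thesis
  proof cases
    case 1
    then have "Poly_Mapping.lookup (?z j) i = 0" unfolding doubleton_eq_iff
      by (elim disjE conjE) (simp_all add: lookup_drop_var)
    then show ?thesis using assms(2) by simp
  next
    case 2
    then have "?z j = ?z k \<or> ?z j = 0" unfolding doubleton_eq_iff by metis
    then have "j = k"
      using assms(2) by (metis lookup_single_eq lookup_zero less_numeral_extra(3))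
    then show ?thesis using 2(2) by blast
  qed
qed

text \<open>A minimal subset of the \<open>k\<close>-th edge set keeps both of its pure powers of
  x_i and has no others, so \<open>k\<close> can be read off from it.\<close>

lemma infinite_min_generating:
  assumes i: "a i = 0"
  shows "infinite (min_generating a)"
proof -
  obtain M where M: "finite M" "degree_basis a M" by (rule ex_degree_basis)
  let ?E = "\<lambda>k. power_edges M i (k + 2) (Suc (k + 2))"
  have "\<exists>E\<subseteq>?E k. E \<in> min_generating a" for k
  proof (rule ex_min_generating_subset)
    show "finite (?E k)" using M(1) by (simp add: power_edges_def)
  qed (rule monom_cong_power_edges[OF M(2) i])+
  then obtain F where F: "F k \<subseteq> ?E k" "F k \<in> min_generating a" for k by metis
  have mem: "{Poly_Mapping.single i j, 0} \<in> F k \<longleftrightarrow> j = k + 2 \<or> j = Suc (k + 2)" if j: "0 < j" for j k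
  proof
    assume "{Poly_Mapping.single i j, 0} \<in> F k"
    then show "j = k + 2 \<or> j = Suc (k + 2)"
      using single_edge_in_power_edges[OF subsetD[OF F(1)] j] by blast
  next
    note monom_cong = min_generatingD(2)[OF F(2)]
    have "{Poly_Mapping.single i (k + 2), 0} \<in> F k"
      by (rule power_edge_needed[OF i F(1) monom_cong]) simp
    \<comment> \<open>With the two exponents exchanged the modulus is \<open>k + 2\<close>; the
      shift by 2 keeps it at least 2.\<close>
    moreover have "{Poly_Mapping.single i (Suc (k + 2)), 0} \<in> F k"
      by (rule power_edge_needed[OF i F(1)[of k, unfolded power_edges_commute[of M i "k + 2" "Suc (k + 2)"]] monom_cong]) simp
    moreover assume "j = k + 2 \<or> j = Suc (k + 2)"
    ultimately show "{Poly_Mapping.single i j, 0} \<in> F k" by blast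
  qed
  have "inj F"
  proof (rule injI)
    fix k l assume eq: "F k = F l"
    have "k + 2 = l + 2 \<or> k + 2 = Suc (l + 2)" using mem[of "k + 2" k] mem[of "k + 2" l] eq by simp
    moreover have "l + 2 = k + 2 \<or> l + 2 = Suc (k + 2)" using mem[of "l + 2" k] mem[of "l + 2" l] eq by simp
    ultimately show "k = l" by linarith
  qed
  then have "infinite (range F)" by (rule range_inj_infinite)
  then show ?thesis using F(2) by (meson finite_subset image_subsetI)
qed

text \<open>By pointedness no degree lies strictly below 0, so the congruence is equality and all
  powers of x_i are isolated vertices of \<open>G(0)\<close>.\<close>

lemma infinite_G_comps_0:
  assumes a: "pointed (NA a)" and i: "a i = 0"
  shows "infinite (G_comps TYPE('k::field) a 0)"
proof -
  have "\<not> less_NA a (deg_A a p) 0" for p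
    unfolding less_NA_iff using pointed_deg_A[OF a] by (metis add.commute)
  then have "edges_below a 0 = {}" unfolding edges_below_def by blast
  moreover have "monom_cong {} = Id" by (simp add: monom_cong_def)
  ultimately have cmp: "fibre_comp a 0 u = {u}" if "u \<in> G_verts a 0" for u
    using that by (auto simp: fibre_comp_def)
  have sub: "(\<lambda>k. {Poly_Mapping.single i k}) ` UNIV \<subseteq> G_comps TYPE('k) a 0"
  proof (rule image_subsetI)
    fix k :: nat
    have "Poly_Mapping.single i k \<in> G_verts a 0" using i by (simp add: G_verts_def deg_A_single)
    then show "{Poly_Mapping.single i k} \<in> G_comps TYPE('k) a 0"
      unfolding G_comps_eq using cmp by (metis imageI)
  qed
  have "inj (\<lambda>k::nat. {Poly_Mapping.single i k})"
    by (rule injI) (metis lookup_single_eq singleton_inject)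
  then have "infinite (range (\<lambda>k::nat. {Poly_Mapping.single i k}))" by (rule range_inj_infinite)
  then show ?thesis using sub finite_subset by blast
qed

section \<open>The product formula with an infinite factor\<close>

lemma enat_prod_eq_0_iff: "finite A \<Longrightarrow> prod f A = (0::enat) \<longleftrightarrow> (\<exists>x\<in>A. f x = 0)"
  by (induction A rule: finite_induct) auto

lemma enat_power_eq_0D: "(x::enat) ^ n = 0 \<Longrightarrow> x = 0"
  by (induction n) auto

text \<open>Since \<open>0 * \<infinity> = 0\<close> on \<open>enat\<close>, an infinite factor
  makes the product infinite only if no factor vanishes.\<close>

lemma G_factor_neq_0:
  assumes b: "b \<in> NA a"
  shows "G_factor TYPE('k::field) a b \<noteq> 0"
proof -
  let ?C = "G_comps TYPE('k) a b"
  have "G_verts a b \<noteq> {}" using b by (auto simp: G_verts_def NA_eq_range)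
  then have ne: "?C \<noteq> {}" by (simp add: G_comps_eq)
  have pos: "ecard C \<noteq> 0" if C: "C \<in> ?C" for C
  proof -
    have "C \<noteq> {}" using C monom_cong_refl by (force simp: G_comps_eq fibre_comp_def)
    then show ?thesis by (simp add: ecard_def zero_enat_def)
  qed
  show ?thesis
  proof (cases "finite ?C")
    case True
    have "(\<Prod>C\<in>?C. ecard C) \<noteq> 0" using True pos by (simp add: enat_prod_eq_0_iff)
    moreover have "(\<Sum>C\<in>?C. ecard C) \<noteq> 0" using True pos ne by auto
    then have "(\<Sum>C\<in>?C. ecard C) ^ (card ?C - 2) \<noteq> 0" using enat_power_eq_0D by blast
    ultimately show ?thesis using True by (simp add: G_factor_def Let_def)
  qed (simp add: G_factor_def Let_def)
qed

lemma nu_toric_ideal_zero: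
  fixes a :: "'m::finite \<Rightarrow> int ^ 'n"
  assumes a: "pointed (NA a)" and i: "a i = 0"
  shows "\<nu> (toric_ideal a :: ('m, 'k::field) mpoly set) =
      (\<Prod>b \<in> {b \<in> NA a. n_comps TYPE('k) a b \<noteq> 1}. G_factor TYPE('k) a b)"
proof -
  define B where "B = {b \<in> NA a. n_comps TYPE('k) a b \<noteq> 1}"
  have finB: "finite B" unfolding B_def by (rule finite_nontrivial_degrees)
  note inf = infinite_G_comps_0[OF a i, where 'k = 'k]
  have "0 \<in> NA a" using deg_A_in_NA[of a 0] by (simp add: deg_A_0)
  then have 0: "0 \<in> B" using inf by (simp add: B_def n_comps_def ecard_def one_enat_def)
  have "(\<Prod>b\<in>B - {0}. G_factor TYPE('k) a b) \<noteq> 0"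
    using finB G_factor_neq_0 by (auto simp: enat_prod_eq_0_iff B_def)
  then have "(\<Prod>b\<in>B. G_factor TYPE('k) a b) = \<infinity>"
    using inf by (simp add: prod.remove[OF finB 0] G_factor_def Let_def imult_is_infinity)
  then show ?thesis
    unfolding nu_toric_ideal B_def[symmetric] using infinite_min_generating[of a i] i by (simp add: ecard_def)
qed

text \<open>Degrees with one component have factor 1 and are left out of the product. Finiteness is
  asserted as well, because \<open>prod\<close> over an infinite set is 1 by convention.\<close>

theorem theorem2p9:
  fixes a :: "'m::finite \<Rightarrow> int ^ 'n"
  assumes "pointed (NA a)"
  shows "finite {b \<in> NA a. n_comps TYPE('k::field) a b \<noteq> 1} \<and>
    \<nu> (toric_ideal a :: ('m, 'k) mpoly set) =
      (\<Prod>b \<in> {b \<in> NA a. n_comps TYPE('k) a b \<noteq> 1}. G_factor TYPE('k) a b)"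
  using finite_nontrivial_degrees nu_toric_ideal_nonzero[OF assms] nu_toric_ideal_zero[OF assms]
  by blast

end
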